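(* Let $d\ge2$ be an integer such that $v_p(d^3-d)\le 2$ for all primes $p\ge5$, $v_3(d^3-d)\le4$, and $v_2(d)\in\{2,3,4\}$. Then there is no tight spherical $7$-design in $\mathbb{R}^n$ with $n=3d^2-4$.
   Context: $v_p$ denotes the $p$-adic valuation. A spherical $7$-design is a finite subset of the unit sphere $S^{n-1}\subset\mathbb{R}^n$ on which every polynomial of degree $\le 7$ has the same average as over the sphere; it is tight if its cardinality equals $2\binom{n+2}{3}$. *)

theory Defs
  imports "HOL-Probability.Probability" "HOL-Computational_Algebra.Primes"
begin

text \<open>The normalized surface measure of the unit sphere, as the radial projection
  \<open>x \<mapsto> x / norm x\<close> of the uniform distribution on the unit ball (equivalently, the normalized
  cone measure).  It is stated on the Borel sets of the ambient space and is concentrated on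
  the sphere: \<open>sgn 0 = 0\<close> only affects a null set.\<close>

definition sphere_measure :: "(real ^ 'n) measure" where
  "sphere_measure = distr (uniform_measure lborel (cball 0 1)) borel sgn"

text \<open>Real polynomial functions of total degree at most \<open>t\<close> in the coordinates;
  \<open>m\<close> ranges over the exponent vectors and \<open>c m\<close> is the coefficient of the monomial.\<close>

definition poly_fun_upto :: "nat \<Rightarrow> (real ^ 'n \<Rightarrow> real) set" where
  "poly_fun_upto t =
     {p. \<exists>c :: ('n \<Rightarrow> nat) \<Rightarrow> real.
           p = (\<lambda>x. \<Sum>m | (\<Sum>i\<in>UNIV. m i) \<le> t. c m * (\<Prod>i\<in>UNIV. (x $ i) ^ m i))}"

definition spherical_design :: "nat \<Rightarrow> (real ^ 'n) set \<Rightarrow> bool" where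
  "spherical_design t X \<longleftrightarrow>
     finite X \<and> X \<noteq> {} \<and> X \<subseteq> sphere 0 1 \<and>
     (\<forall>p \<in> poly_fun_upto t. (\<Sum>x\<in>X. p x) / real (card X) = (\<integral>x. p x \<partial>sphere_measure))"

definition tight_spherical_7_design :: "(real ^ 'n) set \<Rightarrow> bool" where
  "tight_spherical_7_design X \<longleftrightarrow>
     spherical_design 7 X \<and> card X = 2 * ((CARD('n) + 2) choose 3)"

lemma finite_exponents: "finite {m :: 'n::finite \<Rightarrow> nat. (\<Sum>i\<in>UNIV. m i) \<le> t}"
proof (rule finite_subset)
  show "{m :: 'n \<Rightarrow> nat. (\<Sum>i\<in>UNIV. m i) \<le> t} \<subseteq> Pi\<^sub>E UNIV (\<lambda>_. {..t})"
    by (auto intro: order_trans[OF member_le_sum[of _ UNIV]])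
qed (simp add: finite_PiE)

lemma
  shows emeasure_unit_cball: "0 < emeasure lborel (cball (0::real^'n) 1)"
    "emeasure lborel (cball (0::real^'n) 1) < \<infinity>"
  by (simp_all add: emeasure_cball unit_ball_vol_pos)

lemma prob_space_sphere_measure: "prob_space (sphere_measure :: (real ^ 'n) measure)"
  unfolding sphere_measure_def
proof (rule prob_space.prob_space_distr)
  show "prob_space (uniform_measure lborel (cball (0::real^'n) 1))"
    using emeasure_unit_cball[where 'n = 'n]
    by (intro prob_space_uniform_measure) auto
qed simp

lemma AE_sphere_measure: "AE x in (sphere_measure :: (real ^ 'n) measure). x \<in> sphere 0 1"
proof -
  have "AE x in lborel. x \<noteq> (0::real^'n)"
    by (rule AE_lborel_singleton)
  then have "AE x in uniform_measure lborel (cball (0::real^'n) 1). x \<noteq> 0"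
    by (intro AE_uniform_measureI) auto
  then show ?thesis
    unfolding sphere_measure_def
    by (subst AE_distr_iff) (auto simp: norm_sgn elim: eventually_mono)
qed

lemma distr_sphere_measure_orthogonal:
  fixes f :: "real ^ 'n::{finite,wellorder} \<Rightarrow> real ^ 'n::_"
  assumes f: "orthogonal_transformation f"
  shows "distr sphere_measure borel f = sphere_measure"
proof (rule measure_eqI)
  show "sets (distr sphere_measure borel f) = sets sphere_measure"
    by (simp add: sphere_measure_def)
next
  fix A assume "A \<in> sets (distr sphere_measure borel f)"
  then have A[measurable]: "A \<in> sets borel" by simp
  have lin: "linear f" using f by (simp add: orthogonal_transformation_linear)
  have f_meas[measurable]: "f \<in> borel_measurable borel"
    using lin by (intro borel_measurable_continuous_onI linear_continuous_on)
      (simp add: linear_conv_bounded_linear)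
  let ?B = "cball (0::real^'n::_) 1"
  let ?S = "?B \<inter> sgn -` f -` A"
  have fsgn: "sgn (f x) = f (sgn x)" for x
    using f lin by (simp add: sgn_div_norm orthogonal_transformation_norm linear_cmul)
  have S: "?S \<in> sets lborel"
    using measurable_sets[OF measurable_compose[OF borel_measurable_sgn f_meas] A] by (auto simp: vimage_def)
  have T: "?B \<inter> sgn -` A \<in> sets lborel"
    using measurable_sets[OF borel_measurable_sgn A] by auto
  have img: "f ` ?S = ?B \<inter> sgn -` A"
  proof (intro equalityI subsetI)
    fix y assume y: "y \<in> ?B \<inter> sgn -` A"
    obtain x where x: "y = f x"
      using orthogonal_transformation_surj[OF f] by (metis surjD)
    show "y \<in> f ` ?S"
      using y f unfolding x by (auto simp: fsgn orthogonal_transformation_norm)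
  next
    fix y assume "y \<in> f ` ?S"
    then show "y \<in> ?B \<inter> sgn -` A"
      using f by (auto simp: fsgn orthogonal_transformation_norm)
  qed
  have fin: "emeasure lborel (?B \<inter> C) < \<infinity>" for C
    using emeasure_unit_cball(2)
    by (rule le_less_trans[OF emeasure_mono, rotated 2]) auto
  have "?S \<in> lmeasurable"
    using S fin[of "sgn -` f -` A"] by (auto simp: fmeasurable_def)
  then have "measure lebesgue (f ` ?S) = measure lebesgue ?S"
    by (rule measure_orthogonal_image[OF f])
  then have "measure lborel (?B \<inter> sgn -` A) = measure lborel ?S"
    using S T unfolding img by (simp add: measure_completion)
  then have "emeasure lborel (?B \<inter> sgn -` A) = emeasure lborel ?S"
    using fin by (simp add: emeasure_eq_ennreal_measure less_top)
  then show "emeasure (distr sphere_measure borel f) A = emeasure sphere_measure A"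
    using S T measurable_sets[OF f_meas A] measurable_sets[OF borel_measurable_sgn A]
      measurable_sets[OF measurable_compose[OF borel_measurable_sgn f_meas] A]
    by (simp add: sphere_measure_def emeasure_distr vimage_comp comp_def vimage_def)
qed

end

theory Submission
  imports Defs
begin

text \<open>
  Equality in Delsarte's linear programming bound shows that a tight design \<open>X\<close> in dimension
  \<open>n = 3 * d\<^sup>2 - 4\<close> is antipodal with inner products \<open>\<plusminus>1\<close>, \<open>0\<close>, \<open>\<plusminus>1 / d\<close>.  Let \<open>L\<close> be the dual of the lattice
  generated by \<open>sqrt d * X\<close>.  For \<open>a, b \<in> L\<close> the numbers \<open>s = sqrt d * (a \<bullet> x)\<close> and \<open>t = sqrt d * (b \<bullet> x)\<close> are integers, so
  \<open>120\<close> divides \<open>s * (s\<^sup>2 - 1) * (s\<^sup>2 - 4) * t\<close>; the design equations of degrees 2, 4 and 6 evaluate the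
  sum of these products over \<open>X\<close> in terms of \<open>a \<bullet> a\<close> and \<open>a \<bullet> b\<close>.  Under the hypotheses on \<open>d ^ 3 - d\<close>
  the resulting congruences force, prime by prime, that \<open>L\<close> is integral.  As \<open>d\<close> is even, \<open>sqrt d * X\<close> consists
  of vectors of even norm in \<open>L\<close>, so \<open>L\<close> is the dual of its own even part, and Milgram's argument with
  Gauss sums yields \<open>8 dvd n\<close>, whereas \<open>n\<close> is 4 modulo 8.
\<close>

section \<open>Quadratic Gauss sums\<close>

text \<open>The hypotheses on \<open>d\<close> are calibrated to the modulus 120. Antipodality
  doubles it to 240, and for \<open>a = b\<close> a further factor 3 gives 720. A prime
  \<open>p\<close> in the denominator of \<open>a \<bullet> a\<close> would then force
  \<open>p ^ 3\<close> (or \<open>3 ^ 5\<close> when \<open>p = 3\<close>) to divide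
  \<open>d ^ 3 - d\<close>. For two different vectors the denominator is at most 2, by polarization,
  and a half-integral inner product would force 32 to divide \<open>d ^ 3 - d\<close>. The obstacle
  here is that this last argument needs a cofactor that is odd only if one of the vectors has odd
  norm; when both norms are even, the sum of the vectors takes over.

  Milgram's argument needs the argument of a Gauss sum, not only its absolute value, so an analytic
  input is unavoidable in this approach. All even moduli share the same limit, twice a Fresnel
  integral, so the explicit sum for modulus 2 determines every other one and the integral itself
  never has to be evaluated.\<close>

text \<open>The exponent carries \<open>pi\<close> rather than \<open>2 * pi\<close> because it
  models half the norm of a lattice vector. The summand has period \<open>N\<close> in
  \<open>k\<close> exactly when \<open>N\<close> is even.\<close>

definition gauss_sum :: "nat \<Rightarrow> complex" where
  "gauss_sum N = (\<Sum>k<N. cis (pi * real k ^ 2 / real N))"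

lemma norm_cis_minus_one: "norm (cis t - 1) = 2 * \<bar>sin (t / 2)\<bar>"
  using dist_exp_i_1[of t] by (simp add: cis_conv_exp)

lemma norm_cis_diff_le: "norm (cis s - cis t) \<le> \<bar>s - t\<bar>"
proof -
  have "cis s - cis t = cis t * (cis (s - t) - 1)"
    by (simp add: algebra_simps cis_mult)
  then have "norm (cis s - cis t) = 2 * \<bar>sin ((s - t) / 2)\<bar>"
    by (simp add: norm_mult norm_cis_minus_one)
  also have "\<dots> \<le> \<bar>s - t\<bar>"
    using abs_sin_x_le_abs_x[of "(s - t) / 2"] by simp
  finally show ?thesis .
qed

text \<open>Jordan's inequality: sine is concave on this interval, so it lies above its
  chord.\<close>

lemma sin_ge_linear:
  assumes "0 \<le> x" "x \<le> pi / 2"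
  shows "2 * x / pi \<le> sin x"
proof -
  have "convex_on {0..pi/2} (\<lambda>x. - sin x)"
  proof (rule f''_ge0_imp_convex)
    fix x :: real assume "x \<in> {0..pi/2}"
    then show "0 \<le> sin x" by (intro sin_ge_zero) auto
  qed (auto intro!: derivative_eq_intros)
  then have "- sin ((1 - 2 * x / pi) *\<^sub>R 0 + (2 * x / pi) *\<^sub>R (pi / 2))
      \<le> (1 - 2 * x / pi) * - sin 0 + 2 * x / pi * - sin (pi / 2)"
    using assms by (intro convex_onD) (auto simp: field_simps)
  then show ?thesis by simp
qed

text \<open>Summation by parts (Kusmin--Landau): \<open>z k = (z (k + 1) - z k) / w k\<close>, and \<open>1 / w k\<close> has
  small total variation.\<close>

lemma gauss_sum_tail:
  assumes "1 \<le> K" "K \<le> a"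
  shows "norm (\<Sum>k=K..<a. cis (pi * real k ^ 2 / (2 * real a))) \<le> 2 * real a / real K"
proof (cases "K = a")
  case False
  with assms have a: "K < a" "0 < a" by auto
  define z where "z k = cis (pi * real k ^ 2 / (2 * real a))" for k
  \<comment> \<open>\<open>phi k\<close> is the phase increment from \<open>z k\<close> to
    \<open>z (Suc k)\<close>. For \<open>k < a\<close> it stays in \<open>[0, pi]\<close>, so
    \<open>phi k / 2\<close> is within the range of Jordan's inequality.\<close>
  define phi where "phi k = pi * (2 * real k + 1) / (2 * real a)" for k
  define w where "w k = cis (phi k) - 1" for k
  have zz: "z (Suc k) - z k = z k * w k" for k
    by (simp add: z_def w_def phi_def cis_mult algebra_simps power2_eq_square
        flip: add_divide_distrib)
  have wlow: "2 * real k / a \<le> norm (w k)" if "k < a" for k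
  proof -
    have "(2 * real k + 1) / (2 * real a) \<le> 1"
      using that by simp
    from mult_left_mono[OF this pi_ge_zero] have "phi k / 2 \<le> pi / 2"
      by (simp add: phi_def)
    moreover have "0 \<le> phi k / 2" by (simp add: phi_def)
    ultimately have "2 * (phi k / 2) / pi \<le> sin (phi k / 2)" by (rule sin_ge_linear[rotated])
    then have "2 * (2 * (phi k / 2) / pi) \<le> norm (w k)"
      by (simp add: w_def norm_cis_minus_one)
    moreover have "2 * (2 * (phi k / 2) / pi) = (2 * real k + 1) / a"
      using a by (simp add: phi_def field_simps)
    moreover have "2 * real k / a \<le> (2 * real k + 1) / a"
      by (intro divide_right_mono) auto
    ultimately show ?thesis by linarith
  qed
  have w0: "w k \<noteq> 0" if "0 < k" "k < a" for k
    using wlow[OF that(2)] that by (auto simp: field_simps)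
  define g where "g k = inverse (w k)" for k
  have gb: "norm (g k) \<le> a / (2 * real k)" if "0 < k" "k < a" for k
  proof -
    have "inverse (norm (w k)) \<le> inverse (2 * real k / a)"
      using that by (intro le_imp_inverse_le wlow) auto
    then show ?thesis by (simp add: g_def norm_inverse)
  qed
  have zg: "z k = g k * (z (Suc k) - z k)" if "0 < k" "k < a" for k
    using w0[OF that] by (simp add: zz g_def)
  have nz: "norm (z k) = 1" for k by (simp add: z_def)
  \<comment> \<open>The bound is put in telescoping form, so that the total variation of
    \<open>g\<close> from \<open>K\<close> on is of order \<open>a / K\<close>.\<close>
  have gd: "norm (g m - g (Suc m)) \<le> pi * a / 4 * (1 / m - 1 / Suc m)" if "0 < m" "Suc m < a" for m
  proof -
    have "g m - g (Suc m) = (w (Suc m) - w m) * g m * g (Suc m)"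
      using w0[of m] w0[of "Suc m"] that by (simp add: g_def field_simps)
    then have "norm (g m - g (Suc m)) = norm (w (Suc m) - w m) * norm (g m) * norm (g (Suc m))"
      by (simp add: norm_mult)
    also have "\<dots> \<le> (pi / a) * (a / (2 * real m)) * (a / (2 * real (Suc m)))"
    proof (intro mult_mono)
      have "norm (w (Suc m) - w m) \<le> \<bar>phi (Suc m) - phi m\<bar>"
        unfolding w_def using norm_cis_diff_le by simp
      also have "phi (Suc m) - phi m = pi / a"
        using a by (simp add: phi_def field_simps)
      finally show "norm (w (Suc m) - w m) \<le> pi / a" by simp
      show "norm (g m) \<le> a / (2 * real m)" using that by (intro gb) auto
      show "norm (g (Suc m)) \<le> a / (2 * real (Suc m))" using that by (intro gb) auto
    qed auto
    also have "\<dots> = pi * a / 4 * (1 / m - 1 / Suc m)"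
      using that by (simp add: field_simps)
    finally show ?thesis .
  qed
  have ind: "norm ((\<Sum>k=K..<Suc m. z k) - g m * z (Suc m)) \<le> a / (2 * real K) + pi * a / 4 * (1 / K - 1 / m)"
    if "K \<le> m" "m < a" for m
    using that
  proof (induction m rule: dec_induct)
    case base
    have "(\<Sum>k=K..<Suc K. z k) - g K * z (Suc K) = - g K * z K"
      using zg[of K] assms a by (simp add: algebra_simps)
    then have "norm ((\<Sum>k=K..<Suc K. z k) - g K * z (Suc K)) = norm (g K)"
      by (simp add: norm_mult nz)
    then show ?case using gb[of K] assms a by simp
  next
    case (step m)
    have "(\<Sum>k=K..<Suc (Suc m). z k) - g (Suc m) * z (Suc (Suc m))
      = ((\<Sum>k=K..<Suc m. z k) - g m * z (Suc m)) + (g m - g (Suc m)) * z (Suc m)"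
      using zg[of "Suc m"] step by (simp add: algebra_simps)
    also have "norm \<dots> \<le> (a / (2 * real K) + pi * a / 4 * (1 / K - 1 / m)) + pi * a / 4 * (1 / m - 1 / Suc m)"
      using step gd[of m] assms by (intro norm_triangle_mono) (auto simp: norm_mult nz)
    also have "\<dots> = a / (2 * real K) + pi * a / 4 * (1 / K - 1 / Suc m)"
      by (simp only: distrib_left[symmetric] add.assoc) simp
    finally show ?case .
  qed
  obtain m where m: "a = Suc m" "K \<le> m" using a by (cases a) auto
  have "norm (\<Sum>k=K..<a. z k) \<le> norm ((\<Sum>k=K..<a. z k) - g m * z a) + norm (g m * z a)"
    by (metis diff_add_cancel norm_triangle_ineq)
  also have "\<dots> \<le> (a / (2 * real K) + pi * a / 4 * (1 / K - 1 / m)) + a / (2 * real m)"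
    using ind[of m] gb[of m] m assms by (intro add_mono) (auto simp: norm_mult nz)
  also have "\<dots> \<le> (a / (2 * real K) + 1 * real a * (1 / K)) + a / (2 * real K)"
  proof -
    have "pi / 4 * a \<le> 1 * real a"
      using pi_less_4 by (intro mult_right_mono) auto
    then have "pi / 4 * a * (1 / K - 1 / m) \<le> 1 * real a * (1 / K)"
      using m assms by (intro mult_mono[of "pi / 4 * real a"]) (auto simp: frac_le)
    moreover have "real a / (2 * real m) \<le> a / (2 * real K)"
      using m assms by (intro divide_left_mono) auto
    moreover have "pi / 4 * a * (1 / K - 1 / m) = pi * a / 4 * (1 / K - 1 / m)"
      by simp
    ultimately show ?thesis by linarith
  qed
  also have "\<dots> = 2 * real a / real K" by simp
  finally show ?thesis unfolding z_def .
qed simp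

text \<open>The reflection \<open>k \<mapsto> 2 * a - k\<close> folds the sum onto
  \<open>k < a\<close>, the range covered by \<open>gauss_sum_tail\<close>. The error 2 comes from
  the two fixed boundary terms \<open>z a\<close> and \<open>z 0\<close>.\<close>

lemma gauss_sum_double:
  "norm (gauss_sum (2 * a) - 2 * (\<Sum>k<a. cis (pi * real k ^ 2 / (2 * real a)))) \<le> 2"
proof (cases "a = 0")
  case False
  define z where "z k = cis (pi * real k ^ 2 / (2 * real a))" for k
  have z_refl: "z (2 * a - k) = z k" if "k \<le> 2 * a" for k
  proof -
    have "pi * real (2 * a - k) ^ 2 / (2 * real a) = pi * real k ^ 2 / (2 * real a) + 2 * pi * of_int (int a - int k)"
      using that False by (simp add: of_nat_diff field_simps power2_eq_square)
    then show ?thesis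
      by (simp only: z_def flip: cis_mult) simp
  qed
  have "gauss_sum (2 * a) = (\<Sum>k<2*a. z k)"
    by (simp add: gauss_sum_def z_def)
  also have "\<dots> = (\<Sum>k<a. z k) + (\<Sum>k=a..<2*a. z k)"
    by (subst sum.atLeastLessThan_concat[of 0 a "2*a", symmetric, simplified lessThan_atLeast0[symmetric]]) auto
  also have "(\<Sum>k=a..<2*a. z k) = (\<Sum>k\<in>{1..a}. z k)"
    by (rule sum.reindex_bij_witness[of _ "\<lambda>k. 2 * a - k" "\<lambda>k. 2 * a - k"])
       (use False in \<open>auto simp: z_refl\<close>)
  also have "\<dots> = (\<Sum>k<a. z k) - z 0 + z a"
  proof -
    have "{..a} = insert 0 {1..a}" by auto
    then have "(\<Sum>k\<le>a. z k) = z 0 + (\<Sum>k\<in>{1..a}. z k)" by (simp add: sum.insert)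
    then show ?thesis by (simp flip: lessThan_Suc_atMost add: algebra_simps)
  qed
  finally have "gauss_sum (2 * a) - 2 * (\<Sum>k<a. z k) = z a - z 0" by simp
  also have "norm \<dots> \<le> norm (z a) + norm (z 0)" by (rule norm_triangle_ineq4)
  finally show ?thesis by (simp add: z_def)
qed (simp add: gauss_sum_def)

text \<open>Write \<open>k = u + N * c * v\<close>. The sum over \<open>v\<close> runs over powers
  of a \<open>c\<close>-th root of unity and vanishes unless \<open>c\<close> divides
  \<open>u\<close>; the surviving \<open>u = c * w\<close> reproduce the sum for \<open>N\<close>.
  Evenness of \<open>N\<close> removes the term quadratic in \<open>v\<close>.\<close>

lemma gauss_sum_scale:
  assumes "even N" "0 < N" "0 < c"
  shows "gauss_sum (N * c\<^sup>2) = of_nat c * gauss_sum N"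
proof -
  have root: "(\<Sum>v<c. cis (2 * pi * real u * real v / real c)) = (if c dvd u then of_nat c else 0)" for u
  proof (cases "c dvd u")
    case True
    then obtain w where w: "u = c * w" by blast
    have "cis (2 * pi * real u * real v / real c) = 1" for v
    proof -
      have "2 * pi * real u * real v / real c = 2 * pi * of_int (int (w * v))"
        using assms by (simp add: w)
      then show ?thesis by (simp only: cis_multiple_2pi Ints_of_int)
    qed
    then show ?thesis using True by simp
  next
    case False
    define q where "q = cis (2 * pi * real u / real c)"
    have "q \<noteq> 1"
    proof
      assume "q = 1"
      then have "cos (2 * pi * real u / real c) = 1" by (simp add: q_def complex_eq_iff)
      then obtain m :: int where m: "2 * pi * real u / real c = of_int m * 2 * pi"
        by (auto simp: cos_one_2pi_int)
      then have "real u = real c * of_int m"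
        using assms by (simp add: field_simps)
      then have "of_int (int u) = (of_int (int c * m) :: real)" by simp
      then have "int u = int c * m" by (simp only: of_int_eq_iff)
      then have "int c dvd int u" by simp
      then show False using False by simp
    qed
    have "(\<Sum>v<c. cis (2 * pi * real u * real v / real c)) = (\<Sum>v<c. q ^ v)"
      by (intro sum.cong refl) (simp add: q_def Complex.DeMoivre mult_ac)
    also have "\<dots> = (q ^ c - 1) / (q - 1)" using \<open>q \<noteq> 1\<close> by (rule geometric_sum)
    also have "q ^ c = 1"
    proof -
      have "real c * (2 * pi * real u / real c) = 2 * pi * of_int (int u)" using assms by simp
      then show ?thesis by (simp only: q_def Complex.DeMoivre cis_multiple_2pi Ints_of_int)
    qed
    finally show ?thesis using False by simp
  qed
  have summand: "cis (pi * real (u + N * c * v) ^ 2 / real (N * c\<^sup>2))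
      = cis (pi * real u ^ 2 / real (N * c\<^sup>2)) * cis (2 * pi * real u * real v / real c)" for u v
  proof -
    obtain h where h: "N = 2 * h" using assms by blast
    have "pi * real (u + N * c * v) ^ 2 / real (N * c\<^sup>2) =
       (pi * real u ^ 2 / real (N * c\<^sup>2) + 2 * pi * real u * real v / real c) + pi * N * v ^ 2"
      using assms by (simp add: field_simps power2_eq_square)
    also have "pi * N * v ^ 2 = 2 * pi * of_int (int (h * v ^ 2))"
      by (simp add: h)
    finally show ?thesis
      by (simp only: cis_multiple_2pi Ints_of_int flip: cis_mult) simp
  qed
  have bound: "u + N * c * v < N * c * c" if "u < N * c" "v < c" for u v
  proof -
    have "u + N * c * v < N * c * Suc v" using that by simp
    also have "\<dots> \<le> N * c * c" using that by (intro mult_le_mono) auto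
    finally show ?thesis .
  qed
  define P where "P = N * c"
  have P: "0 < P" using assms by (simp add: P_def)
  have "gauss_sum (N * c\<^sup>2) = (\<Sum>k<P*c. cis (pi * real k ^ 2 / real (N * c\<^sup>2)))"
    by (simp add: gauss_sum_def P_def power2_eq_square mult.assoc)
  also have "\<dots> = (\<Sum>(u,v)\<in>{..<P}\<times>{..<c}. cis (pi * real (u + P * v) ^ 2 / real (N * c\<^sup>2)))"
    by (rule sum.reindex_bij_witness[of _ "\<lambda>(u, v). u + P * v" "\<lambda>k. (k mod P, k div P)"])
       (use P bound in \<open>auto simp: less_mult_imp_div_less mult.commute simp flip: P_def of_nat_add of_nat_mult\<close>)
  also have "\<dots> = (\<Sum>u<N*c. \<Sum>v<c. cis (pi * real (u + N * c * v) ^ 2 / real (N * c\<^sup>2)))"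
    by (simp add: P_def sum.cartesian_product)
  also have "\<dots> = (\<Sum>u<N*c. if c dvd u then of_nat c * cis (pi * real u ^ 2 / real (N * c\<^sup>2)) else 0)"
    unfolding summand by (intro sum.cong refl) (simp add: root flip: sum_distrib_left)
  also have "\<dots> = (\<Sum>u | u < N * c \<and> c dvd u. of_nat c * cis (pi * real u ^ 2 / real (N * c\<^sup>2)))"
    by (subst sum.inter_filter[symmetric]) simp_all
  also have "\<dots> = (\<Sum>w<N. of_nat c * cis (pi * real w ^ 2 / real N))"
    by (rule sum.reindex_bij_witness[of _ "\<lambda>w. c * w" "\<lambda>u. u div c"])
       (use assms in \<open>auto simp: power_mult_distrib field_simps\<close>)
  finally show ?thesis by (simp add: gauss_sum_def sum_distrib_left)
qed

lemma gauss_sum_2: "gauss_sum 2 = 1 + \<i>"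
  by (simp add: gauss_sum_def numeral_2_eq_2)

text \<open>With \<open>T = h * K\<close>, the integrand has Lipschitz constant
  \<open>2 * pi * T\<close> on \<open>[0, T]\<close>. Each of the \<open>K\<close> cells of width
  \<open>h\<close> therefore contributes an error of at most
  \<open>h * (2 * pi * T * h)\<close>.\<close>

lemma fresnel_riemann_sum:
  defines "f \<equiv> \<lambda>u. cis (pi * u\<^sup>2)"
  assumes "0 \<le> h"
  shows "norm (h * (\<Sum>k<K. f (h * real k)) - integral {0..h * real K} f) \<le> 2 * pi * h * (h * real K)\<^sup>2"
proof -
  define F where "F u = integral {0..u} f" for u
  define T where "T = h * real K"
  have cont: "continuous_on A f" for A
    by (auto simp: f_def intro!: continuous_intros)
  have T: "h * real k \<le> T" if "k \<le> K" for k using that assms by (simp add: T_def mult_left_mono)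
  have F: "(F has_vector_derivative f u) (at u within {0..T})" if "u \<in> {0..T}" for u
    unfolding F_def using that by (intro integral_has_vector_derivative cont) auto
  have step: "norm (F (h * real (Suc k)) - F (h * real k) - h * f (h * real k)) \<le> h * (2 * pi * T * h)"
    if "k < K" for k
  proof -
    let ?S = "{h * real k..h * real (Suc k)}"
    have le: "h * real k \<le> h * real (Suc k)" using assms by (simp add: mult_left_mono)
    have sub: "?S \<subseteq> {0..T}" using T[of "Suc k"] that assms by (auto intro: order_trans[of 0 "h * real k"])
    have "norm (F (h * real (Suc k)) - F (h * real k) - (h * real (Suc k) - h * real k) *\<^sub>R f (h * real k))
       \<le> norm (h * real (Suc k) - h * real k) * (2 * pi * T * h)"
    proof (rule vector_differentiable_bound_linearization[where S = ?S])
      fix x assume x: "x \<in> ?S"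
      show "(F has_vector_derivative f x) (at x within ?S)"
        using F sub x by (blast intro: has_vector_derivative_within_subset)
      have hk0: "0 \<le> h * real k" using assms by simp
      have xT: "x \<in> {0..T}" using x sub by blast
      then have x0: "0 \<le> x" and xT: "x \<le> T" and T0: "0 \<le> T" by auto
      have "norm (f x - f (h * real k)) \<le> \<bar>pi * x\<^sup>2 - pi * (h * real k)\<^sup>2\<bar>"
        unfolding f_def by (rule norm_cis_diff_le)
      also have "pi * x\<^sup>2 - pi * (h * real k)\<^sup>2 = pi * (x + h * real k) * (x - h * real k)"
        by (simp add: algebra_simps power2_eq_square)
      also have "\<bar>\<dots>\<bar> = pi * (x + h * real k) * (x - h * real k)"
        by (rule abs_of_nonneg, intro mult_nonneg_nonneg add_nonneg_nonneg x0 hk0) (use x in auto)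
      also have "\<dots> \<le> pi * (T + T) * h"
        by (intro mult_mono add_mono mult_nonneg_nonneg add_nonneg_nonneg x0 hk0 T0 xT T)
          (use x that in \<open>auto simp: algebra_simps\<close>)
      finally show "norm (f x - f (h * real k)) \<le> 2 * pi * T * h" by (simp add: algebra_simps)
    qed (use le in \<open>auto simp: closed_segment_eq_real_ivl\<close>)
    then show ?thesis using assms by (simp add: algebra_simps scaleR_conv_of_real)
  qed
  have "F (h * real K) - F 0 = (\<Sum>k<K. F (h * real (Suc k)) - F (h * real k))"
    by (subst sum_lessThan_telescope) simp
  then have "h * (\<Sum>k<K. f (h * real k)) - F (h * real K)
     = - (\<Sum>k<K. F (h * real (Suc k)) - F (h * real k) - h * f (h * real k))"
    by (simp add: F_def sum_subtractf sum_distrib_left)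
  then have "norm (h * (\<Sum>k<K. f (h * real k)) - F (h * real K))
     \<le> (\<Sum>k<K. norm (F (h * real (Suc k)) - F (h * real k) - h * f (h * real k)))"
    by (simp only: norm_minus_cancel norm_sum)
  also have "\<dots> \<le> (\<Sum>k<K. h * (2 * pi * T * h))" by (intro sum_mono step) auto
  also have "\<dots> = 2 * pi * h * T\<^sup>2" by (simp add: T_def power2_eq_square)
  finally show ?thesis by (simp add: F_def T_def)
qed


text \<open>Replacing \<open>N\<close> by \<open>N * c\<^sup>2\<close> does not change the left-hand side (\<open>gauss_sum_scale\<close>), but for \<open>c \<rightarrow> \<infinity>\<close> the sum
  becomes a Riemann sum of the Fresnel integral.\<close>

lemma gauss_sum_fresnel:
  assumes "even N" "0 < N" "0 < T"
  shows "norm (gauss_sum N / sqrt N - 2 * integral {0..real T} (\<lambda>u. cis (pi * u\<^sup>2))) \<le> 2 / real T"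
proof -
  define f where "f u = cis (pi * u\<^sup>2)" for u :: real
  \<comment> \<open>Collects the errors proportional to the mesh \<open>h\<close>: the first summand
    is twice the Riemann sum error, the 4 covers the folding error and the overshoot of the grid
    beyond \<open>T\<close>.\<close>
  define C where "C = 4 * pi * (real T + 1)\<^sup>2 + 4"
  let ?G = "gauss_sum N / sqrt N - 2 * integral {0..real T} f"
  have intf: "f integrable_on {x..y}" for x y
    by (intro integrable_continuous_real) (auto simp: f_def intro!: continuous_intros)
  have sN: "1 \<le> sqrt N" using assms by simp
  have main: "norm ?G \<le> 2 / real T + C / real c" if c: "4 * T \<le> c" for c
  proof -
    have c0: "0 < c" using c assms by simp
    \<comment> \<open>The mesh is chosen such that
      \<open>pi * k ^ 2 / (2 * a) = pi * (h * k) ^ 2\<close>. The sum up to \<open>K\<close>, the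
      first grid index reaching \<open>T\<close>, is the Riemann sum; the rest is the tail.\<close>
    define h where "h = 1 / (real c * sqrt N)"
    define a where "a = N div 2 * c\<^sup>2"
    define K where "K = nat \<lceil>real T / h\<rceil>"
    have h0: "0 < h" using c0 assms by (simp add: h_def)
    have hc: "h \<le> 1 / real c" using c0 sN assms unfolding h_def by (intro divide_left_mono) auto
    have a2: "N * c\<^sup>2 = 2 * a" using assms by (simp add: a_def)
    have h2: "h\<^sup>2 * (2 * real a) = 1"
    proof -
      have "2 * real a = real (N * c\<^sup>2)" by (simp only: a2)
      then show ?thesis using c0 assms by (simp add: h_def field_simps power2_eq_square)
    qed
    have K1: "real T / h \<le> real K" "real K \<le> real T / h + 1"
      using h0 assms by (auto simp: K_def intro: less_imp_le)
    have hK: "real T \<le> h * real K" "h * real K \<le> real T + h"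
      using K1 h0 by (auto simp: field_simps)
    have "1 / real c \<le> 1" using c0 by simp
    with hc have h1: "h \<le> 1" by linarith
    have Th: "1 \<le> real T / h" using h1 h0 assms by (simp add: field_simps)
    have K0: "1 \<le> K" using Th K1 by linarith
    have Ka: "K \<le> a"
    proof -
      have "real K \<le> 2 * (real T / h)" using Th K1 by linarith
      also have "\<dots> = 2 * real T * (h * (2 * real a))"
        using h2 h0 by (simp add: field_simps power2_eq_square)
      also have "\<dots> = (4 * real T * h) * a" by simp
      also have "\<dots> \<le> (real c * h) * a"
        using c h0 by (intro mult_right_mono) auto
      also have "\<dots> \<le> 1 * real a"
        using hc c0 by (intro mult_right_mono) (auto simp: field_simps)
      finally show ?thesis by simp
    qed
    define z where "z k = cis (pi * real k ^ 2 / (2 * real a))" for k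
    have zf: "z k = f (h * real k)" for k
    proof -
      have "(h * real k)\<^sup>2 = real k ^ 2 / (2 * real a)"
        using eq_divide_imp[OF _ h2] Ka K0 by (simp add: power_mult_distrib)
      then show ?thesis by (simp add: z_def f_def)
    qed
    have gG: "gauss_sum N / sqrt N = h * gauss_sum (2 * a)"
      using c0 gauss_sum_scale[OF assms(1,2) c0] by (simp add: h_def flip: a2)
    have e1: "norm (h * gauss_sum (2 * a) - 2 * (h * (\<Sum>k<a. z k))) \<le> 2 * h"
    proof -
      have "h * gauss_sum (2 * a) - 2 * (h * (\<Sum>k<a. z k)) = h * (gauss_sum (2 * a) - 2 * (\<Sum>k<a. z k))"
        by (simp add: algebra_simps)
      also have "norm \<dots> = h * norm (gauss_sum (2 * a) - 2 * (\<Sum>k<a. z k))"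
        using h0 by (simp add: norm_mult)
      also have "\<dots> \<le> h * 2"
        unfolding z_def using h0 gauss_sum_double[of a] by (intro mult_left_mono) auto
      finally show ?thesis by simp
    qed
    have e2: "norm (h * (\<Sum>k=K..<a. z k)) \<le> 1 / real T"
    proof -
      have "norm (h * (\<Sum>k=K..<a. z k)) \<le> h * (2 * real a / real K)"
        unfolding z_def using mult_left_mono[OF gauss_sum_tail[OF K0 Ka], of h] h0 by (simp add: norm_mult)
      also have "\<dots> = 1 / (h * real K)"
        using h2 h0 K0 by (simp add: field_simps power2_eq_square)
      also have "\<dots> \<le> 1 / real T" using hK h0 K0 assms by (intro divide_left_mono) auto
      finally show ?thesis .
    qed
    have e3: "norm (h * (\<Sum>k<K. z k) - integral {0..h * real K} f) \<le> 2 * pi * h * (real T + 1)\<^sup>2"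
    proof -
      have "norm (h * (\<Sum>k<K. z k) - integral {0..h * real K} f) \<le> 2 * pi * h * (h * real K)\<^sup>2"
        using fresnel_riemann_sum[of h K] h0 by (simp add: zf flip: f_def)
      also have "\<dots> \<le> 2 * pi * h * (real T + 1)\<^sup>2"
        using hK h0 h1 K0 by (intro mult_left_mono power_mono) auto
      finally show ?thesis .
    qed
    have e4: "norm (integral {0..h * real K} f - integral {0..real T} f) \<le> h"
    proof -
      have "integral {0..h * real K} f - integral {0..real T} f = integral {real T..h * real K} f"
        using hK Henstock_Kurzweil_Integration.integral_combine[of 0 "real T" "h * real K" f] intf
        by (simp add: algebra_simps)
      also have "norm \<dots> \<le> 1 * (h * real K - real T)"
        using hK by (intro integral_bound) (auto simp: f_def intro!: continuous_intros)
      finally show ?thesis using hK by simp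
    qed
    have twice: "norm (2 * w) \<le> 2 * b" if "norm w \<le> b" for w :: complex and b
      using that by (simp add: norm_mult)
    have split: "(\<Sum>k<a. z k) = (\<Sum>k<K. z k) + (\<Sum>k=K..<a. z k)"
      using Ka by (simp add: lessThan_atLeast0 sum.atLeastLessThan_concat)
    have "?G = (h * gauss_sum (2 * a) - 2 * (h * (\<Sum>k<a. z k))) + 2 * (h * (\<Sum>k=K..<a. z k))
        + 2 * (h * (\<Sum>k<K. z k) - integral {0..h * real K} f)
        + 2 * (integral {0..h * real K} f - integral {0..real T} f)"
      unfolding gG split by (simp add: algebra_simps)
    also have "norm \<dots> \<le> 2 * h + 2 * (1 / real T) + 2 * (2 * pi * h * (real T + 1)\<^sup>2) + 2 * h"
      by (intro norm_triangle_mono twice e1 e2 e3 e4)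
    also have "\<dots> = 2 / real T + C * h" by (simp add: C_def algebra_simps)
    also have "\<dots> \<le> 2 / real T + C * (1 / real c)"
      using hc by (intro add_left_mono mult_left_mono) (auto simp: C_def)
    finally show ?thesis by simp
  qed
  have "norm ?G \<le> 2 / real T + 0"
  proof (rule tendsto_lowerbound)
    show "(\<lambda>c. 2 / real T + C / real c) \<longlonglongrightarrow> 2 / real T + 0"
      by (intro tendsto_intros lim_const_over_n)
    show "\<forall>\<^sub>F c in sequentially. norm ?G \<le> 2 / real T + C / real c"
      using main eventually_ge_at_top by (rule eventually_mono[rotated])
  qed auto
  then show ?thesis by (simp add: f_def[abs_def])
qed

text \<open>The Fresnel integral cancels: the normalized sums for \<open>N\<close> and for 2 differ
  by at most \<open>4 / T\<close> for every \<open>T\<close>, hence agree, and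
  \<open>1 + \<i>\<close> has argument \<open>pi / 4\<close>.\<close>

theorem gauss_sum_even:
  assumes "even N" "0 < N"
  shows "gauss_sum N = sqrt N * cis (pi / 4)"
proof -
  let ?g = "\<lambda>N. gauss_sum N / sqrt (real N)"
  have "norm (?g N - ?g 2) \<le> 0"
  proof (rule tendsto_lowerbound)
    show "(\<lambda>T. 4 / real T) \<longlonglongrightarrow> 0" by (rule lim_const_over_n)
    have "norm (?g N - ?g 2) \<le> 4 / real T" if "1 \<le> T" for T
      using norm_triangle_mono[OF gauss_sum_fresnel[OF assms, of T]
          gauss_sum_fresnel[of 2 T, unfolded norm_minus_commute[of "?g 2"]]] that
      by (simp add: algebra_simps)
    then show "\<forall>\<^sub>F T in sequentially. norm (?g N - ?g 2) \<le> 4 / real T"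
      using eventually_ge_at_top by (rule eventually_mono[rotated])
  qed auto
  then have "?g N = ?g 2" by simp
  also have "?g 2 = cis (pi / 4)"
    by (simp add: gauss_sum_2 complex_eq_iff cos_45 sin_45 field_simps)
  finally show ?thesis using assms by (simp add: field_simps)
qed

section \<open>Dimensions of unimodular lattices\<close>

lemma cis_sum: "finite A \<Longrightarrow> cis (\<Sum>i\<in>A. f i) = (\<Prod>i\<in>A. cis (f i))"
  by (induction A rule: finite_induct) (auto simp flip: cis_mult)

lemma cis_2pi_eq_1D:
  assumes "cis (2 * pi * x) = 1"
  shows "x \<in> \<int>"
proof -
  have "cos (2 * pi * x) = 1" using assms by (simp add: complex_eq_iff)
  then obtain m :: int where "2 * pi * x = of_int m * 2 * pi"
    by (auto simp: cos_one_2pi_int)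
  then have "x = of_int m" by simp
  then show ?thesis by simp
qed

lemma sum_eq_0_by_invariance:
  fixes S :: complex
  assumes "c * S = S" "c \<noteq> 1"
  shows "S = 0"
  using assms by simp

lemma sum_residues_shift:
  fixes N :: "'n::finite \<Rightarrow> nat" and F :: "('n \<Rightarrow> int) \<Rightarrow> 'a::comm_monoid_add"
  defines "R \<equiv> PiE UNIV (\<lambda>i. {0..<int (N i)})"
  assumes N: "\<And>i. 0 < N i"
    and F: "\<And>k k'. (\<And>i. int (N i) dvd k i - k' i) \<Longrightarrow> F k = F k'"
  shows "(\<Sum>k\<in>R. F (\<lambda>i. k i + l i)) = (\<Sum>k\<in>R. F k)"
proof (rule sum.reindex_bij_witness[of _ "\<lambda>k i. (k i - l i) mod int (N i)" "\<lambda>k i. (k i + l i) mod int (N i)"])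
  fix k assume k: "k \<in> R"
  then have kk: "0 \<le> k i" "k i < int (N i)" for i by (auto simp: R_def PiE_def Pi_def)
  show "(\<lambda>i. ((k i + l i) mod int (N i) - l i) mod int (N i)) = k"
    using kk by (auto simp: fun_eq_iff mod_simps)
  show "(\<lambda>i. ((k i - l i) mod int (N i) + l i) mod int (N i)) = k"
    using kk by (auto simp: fun_eq_iff mod_simps)
  show "(\<lambda>i. (k i + l i) mod int (N i)) \<in> R" "(\<lambda>i. (k i - l i) mod int (N i)) \<in> R"
    using N by (auto simp: R_def PiE_def Pi_def)
  show "F (\<lambda>i. (k i + l i) mod int (N i)) = F (\<lambda>i. k i + l i)"
    by (rule F) (simp add: mod_eq_dvd_iff[symmetric])
qed

text \<open>Milgram's Gauss sum argument.  In coordinates with respect to an orthogonal basis \<open>b i\<close> of norm \<open>N i\<close>,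
  \<open>k\<close> stands for the vector with \<open>k i = x \<bullet> b i\<close>, so \<open>B\<close> is the inner product and \<open>R\<close> represents the dual of
  \<open>\<Oplus> \<int> b i\<close> modulo \<open>\<Oplus> \<int> b i\<close>.  Averaging the Gauss sum over \<open>R\<close> under translations by even vectors of \<open>H\<close>
  leaves only the terms in \<open>H\<close>, where the summand is a character with values \<open>\<plusminus>1\<close>; hence the sum is a
  nonnegative real, whereas as a product of one-dimensional sums it has argument \<open>n \<pi> / 4\<close>.\<close>

lemma self_dual_even_part_dim:
  fixes N :: "'n::finite \<Rightarrow> nat" and H :: "('n \<Rightarrow> int) set"
  defines "B \<equiv> \<lambda>k l. \<Sum>i\<in>UNIV. of_int (k i * l i) / real (N i)"
  assumes N: "\<And>i. even (N i)" "\<And>i. 0 < N i"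
    and int: "\<And>k l. k \<in> H \<Longrightarrow> l \<in> H \<Longrightarrow> B k l \<in> \<int>"
    and dual: "\<And>k. (\<And>l. l \<in> H \<Longrightarrow> B l l / 2 \<in> \<int> \<Longrightarrow> B k l \<in> \<int>) \<Longrightarrow> k \<in> H"
  shows "8 dvd CARD('n)"
proof -
  define E where "E = {l \<in> H. B l l / 2 \<in> \<int>}"
  define R where "R = PiE (UNIV :: 'n set) (\<lambda>i. {0..<int (N i)})"
  define phi where "phi k = cis (pi * B k k)" for k
  define cong where "cong k k' \<longleftrightarrow> (\<forall>i. int (N i) dvd k i - k' i)" for k k'
  have N0: "N i \<noteq> 0" for i using N(2)[of i] by simp
  \<comment> \<open>Even norms make \<open>B k k / 2\<close> well defined modulo 1 on residue
    classes, so that \<open>phi\<close> is a function on the finite quotient represented by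
    \<open>R\<close>.\<close>
  have N_half: "int (N i) = 2 * int (N i div 2)" for i
  proof -
    have "N i = 2 * (N i div 2)" using N(1)[of i] by simp
    then show ?thesis by presburger
  qed
  have finR: "finite R" by (simp add: R_def finite_PiE)
  have B_sym: "B k l = B l k" for k l by (simp add: B_def mult.commute)
  have B_add: "B (\<lambda>i. k i + l i) m = B k m + B l m" for k l m
    by (simp add: B_def ring_distribs add_divide_distrib sum.distrib)
  have B_add': "B m (\<lambda>i. k i + l i) = B m k + B m l" for k l m
    by (simp add: B_def ring_distribs add_divide_distrib sum.distrib)
  have cong_decomp: "\<exists>r. k = (\<lambda>i. k' i + int (N i) * r i)" if "cong k k'" for k k'
    using that unfolding cong_def dvd_def by (metis (mono_tags) diff_add_cancel add.commute)
  have B_N: "B (\<lambda>i. int (N i) * r i) l = of_int (\<Sum>i\<in>UNIV. r i * l i)" for r l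
    unfolding B_def of_int_sum by (intro sum.cong refl) (simp add: N0)
  have B_cong: "B k l - B k' l \<in> \<int>" if "cong k k'" for k k' l
  proof -
    obtain r where r: "k = (\<lambda>i. k' i + int (N i) * r i)" using cong_decomp[OF \<open>cong k k'\<close>] by blast
    show ?thesis unfolding r B_add B_N add_diff_cancel_left' by (rule Ints_of_int)
  qed
  have q_add: "B (\<lambda>i. k i + l i) (\<lambda>i. k i + l i) = B k k + 2 * B k l + B l l" for k l
    by (simp add: B_add B_add' B_sym[of l k])
  have q_cong: "(B k k - B k' k') / 2 \<in> \<int>" if "cong k k'" for k k'
  proof -
    obtain r where r: "k = (\<lambda>i. k' i + int (N i) * r i)" using cong_decomp[OF \<open>cong k k'\<close>] by blast
    have "B k k - B k' k' = 2 * B (\<lambda>i. int (N i) * r i) k' + B (\<lambda>i. int (N i) * r i) (\<lambda>i. int (N i) * r i)"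
      unfolding r by (simp add: q_add B_sym)
    then have "(B k k - B k' k') / 2 = of_int (\<Sum>i\<in>UNIV. r i * k' i) + of_int (\<Sum>i\<in>UNIV. r i * (int (N i) * r i)) / 2"
      unfolding B_N by simp
    also have "(\<Sum>i\<in>UNIV. r i * (int (N i) * r i)) = 2 * (\<Sum>i\<in>UNIV. r i * (int (N i div 2) * r i))"
      unfolding sum_distrib_left by (intro sum.cong refl, subst N_half) (simp only: mult_ac)
    finally have "(B k k - B k' k') / 2 = of_int ((\<Sum>i\<in>UNIV. r i * k' i) + (\<Sum>i\<in>UNIV. r i * (int (N i div 2) * r i)))"
      by (simp del: of_int_sum)
    then show ?thesis by (simp only: Ints_of_int)
  qed
  have H_cong: "k \<in> H" if "cong k k'" "k' \<in> H" for k k'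
  proof (rule dual)
    fix l assume "l \<in> H"
    then have "B k l - B k' l \<in> \<int>" "B k' l \<in> \<int>" using that by (auto intro: B_cong int)
    then show "B k l \<in> \<int>" using Ints_add by fastforce
  qed
  have cong_sym: "cong k k'" if "cong k' k" for k k'
    using that unfolding cong_def by (metis dvd_minus_iff minus_diff_eq)
  have H_cong_iff: "k \<in> H \<longleftrightarrow> k' \<in> H" if "cong k k'" for k k'
    using H_cong cong_sym that by blast
  have E_cong_iff: "k \<in> E \<longleftrightarrow> k' \<in> E" if "cong k k'" for k k'
  proof -
    have "B k k / 2 \<in> \<int> \<longleftrightarrow> B k' k' / 2 \<in> \<int>"
      using q_cong[OF that] Ints_add[of "(B k k - B k' k') / 2" "B k' k' / 2"]
        Ints_diff[of "B k k / 2" "(B k k - B k' k') / 2"] by (auto simp: field_simps)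
    then show ?thesis using H_cong_iff[OF that] by (simp add: E_def)
  qed
  have phi_cong: "phi k = phi k'" if "cong k k'" for k k'
  proof -
    have "pi * B k k = pi * B k' k' + 2 * pi * ((B k k - B k' k') / 2)" by (simp add: field_simps)
    then have "phi k = cis (pi * B k' k') * cis (2 * pi * ((B k k - B k' k') / 2))"
      unfolding phi_def by (simp only: cis_mult)
    then show ?thesis by (simp only: cis_multiple_2pi[OF q_cong[OF that]] phi_def mult_1_right)
  qed
  have phi_add: "phi (\<lambda>i. k i + l i) = phi k * cis (2 * pi * B k l) * phi l" for k l
    unfolding phi_def q_add cis_mult by (simp add: algebra_simps)
  have shift: "(\<Sum>k\<in>R. F (\<lambda>i. k i + l i)) = (\<Sum>k\<in>R. F k)"
    if "\<And>k k'. cong k k' \<Longrightarrow> F k = F k'" for F :: "('n \<Rightarrow> int) \<Rightarrow> complex" and l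
    unfolding R_def using N(2) that by (intro sum_residues_shift) (auto simp: cong_def)
  have H_add: "(\<lambda>i. k i + l i) \<in> H \<longleftrightarrow> k \<in> H" if "l \<in> H" for k l
  proof
    assume kl: "(\<lambda>i. k i + l i) \<in> H"
    show "k \<in> H"
    proof (rule dual)
      fix m assume "m \<in> H"
      then show "B k m \<in> \<int>" using int[OF kl, of m] int[OF that, of m] Ints_diff unfolding B_add by fastforce
    qed
  next
    assume k: "k \<in> H"
    show "(\<lambda>i. k i + l i) \<in> H"
    proof (rule dual)
      fix m assume "m \<in> H"
      then show "B (\<lambda>i. k i + l i) m \<in> \<int>" using int[OF k, of m] int[OF that, of m] unfolding B_add by simp
    qed
  qed
  have E_add: "(\<lambda>i. k i + l i) \<in> E \<longleftrightarrow> k \<in> E" if "l \<in> E" for k l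
  proof -
    have "B (\<lambda>i. k i + l i) (\<lambda>i. k i + l i) / 2 \<in> \<int> \<longleftrightarrow> B k k / 2 \<in> \<int>" if "k \<in> H"
    proof -
      have "B k l + B l l / 2 \<in> \<int>" using int[OF that, of l] \<open>l \<in> E\<close> by (auto simp: E_def)
      moreover have "B (\<lambda>i. k i + l i) (\<lambda>i. k i + l i) / 2 = B k k / 2 + (B k l + B l l / 2)"
        unfolding q_add by simp
      ultimately show ?thesis by (metis Ints_add Ints_diff add_diff_cancel_right')
    qed
    then show ?thesis using that H_add[of l k] by (auto simp: E_def)
  qed
  have zero_E: "(\<lambda>_. 0) \<in> E"
    using dual[of "\<lambda>_. 0"] by (simp add: E_def B_def)
  define G where "G = (\<Sum>k\<in>R. phi k)"
  \<comment> \<open>Translation by \<open>l\<close> permutes the residue classes, and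
    \<open>phi l = 1\<close> for an even vector, so only the bilinear term remains.\<close>
  have G_shift: "(\<Sum>k\<in>R. phi k * cis (2 * pi * B k l)) = G" if "l \<in> E" for l
  proof -
    have "phi l = cis (2 * pi * (B l l / 2))" by (simp add: phi_def)
    also have "\<dots> = 1" using that by (intro cis_multiple_2pi) (simp add: E_def)
    finally show ?thesis using shift[of phi l, OF phi_cong] by (simp add: phi_add G_def)
  qed
  \<comment> \<open>Orthogonality of characters on \<open>E\<close>: for \<open>k \<notin> H\<close>
    the duality hypothesis supplies an even vector on which the character of \<open>k\<close> is
    nontrivial.\<close>
  have char_sum: "(\<Sum>l\<in>R. if l \<in> E then cis (2 * pi * B k l) else 0) = (if k \<in> H then of_nat (card (R \<inter> E)) else 0)" for k
  proof (cases "k \<in> H")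
    case True
    then have "(if l \<in> E then cis (2 * pi * B k l) else 0) = (if l \<in> E then 1 else 0)" for l
      by (auto simp: E_def intro: cis_multiple_2pi int)
    then show ?thesis using True finR by (simp add: sum.If_cases Int_def)
  next
    case False
    then obtain m where m: "m \<in> E" "B k m \<notin> \<int>" using dual[of k] by (auto simp: E_def)
    let ?S = "\<Sum>l\<in>R. if l \<in> E then cis (2 * pi * B k l) else 0"
    have "cis (2 * pi * B k m) * ?S = (\<Sum>l\<in>R. if (\<lambda>i. l i + m i) \<in> E then cis (2 * pi * B k (\<lambda>i. l i + m i)) else 0)"
      unfolding sum_distrib_left
      by (intro sum.cong refl) (simp add: E_add[OF m(1)] B_add' ring_distribs mult.commute flip: cis_mult)
    also have "\<dots> = ?S"
    proof (rule shift)
      fix l l' assume c: "cong l l'"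
      have "cis (2 * pi * B k l) = cis (2 * pi * B k l') * cis (2 * pi * (B l k - B l' k))"
        by (simp add: B_sym[of k] cis_mult algebra_simps)
      also have "\<dots> = cis (2 * pi * B k l')" using c by (simp only: cis_multiple_2pi B_cong mult_1_right)
      finally show "(if l \<in> E then cis (2 * pi * B k l) else 0) = (if l' \<in> E then cis (2 * pi * B k l') else 0)"
        using E_cong_iff[OF c] by simp
    qed
    finally have "?S = 0" using cis_2pi_eq_1D m(2) by (blast intro: sum_eq_0_by_invariance)
    then show ?thesis using False by simp
  qed
  have G_H: "G = (\<Sum>k\<in>R. if k \<in> H then phi k else 0)"
  proof -
    \<comment> \<open>Sum \<open>G_shift\<close> over all \<open>l\<close> in
      \<open>R \<inter> E\<close> and exchange the two sums; \<open>char_sum\<close> then discards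
      every \<open>k\<close> outside \<open>H\<close>.\<close>
    have "of_nat (card (R \<inter> E)) * G = (\<Sum>l\<in>R. if l \<in> E then G else 0)"
      using finR by (simp add: sum.If_cases Int_def)
    also have "\<dots> = (\<Sum>l\<in>R. \<Sum>k\<in>R. phi k * (if l \<in> E then cis (2 * pi * B k l) else 0))"
      by (intro sum.cong refl) (simp add: G_shift)
    also have "\<dots> = (\<Sum>k\<in>R. phi k * (\<Sum>l\<in>R. if l \<in> E then cis (2 * pi * B k l) else 0))"
      by (subst sum.swap) (simp only: sum_distrib_left)
    also have "\<dots> = of_nat (card (R \<inter> E)) * (\<Sum>k\<in>R. if k \<in> H then phi k else 0)"
      unfolding char_sum sum_distrib_left by (intro sum.cong refl) simp
    finally have "of_nat (card (R \<inter> E)) * G = of_nat (card (R \<inter> E)) * (\<Sum>k\<in>R. if k \<in> H then phi k else 0)" .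
    moreover have "(\<lambda>_. 0) \<in> R \<inter> E" using zero_E N(2) by (auto simp: R_def)
    then have "card (R \<inter> E) \<noteq> 0" using finR by auto
    ultimately show ?thesis by simp
  qed
  have phi_H: "phi k = 1 \<or> phi k = - 1" if k: "k \<in> H" for k
  proof -
    obtain m :: int where m: "B k k = of_int m" using int[OF k k] by (auto elim: Ints_cases)
    have "phi k * phi k = cis (2 * pi * B k k)" by (simp add: phi_def cis_mult mult.assoc)
    also have "\<dots> = 1" by (rule cis_multiple_2pi) (simp add: m)
    finally show ?thesis by (simp add: square_eq_1_iff)
  qed
  \<comment> \<open>On \<open>H\<close> the form is integral, so \<open>phi\<close> is
    multiplicative there: its sum is the number of classes if \<open>phi\<close> is trivial and 0
    otherwise.\<close>
  have "\<exists>r\<ge>0. G = of_real r"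
  proof (cases "\<exists>m\<in>H. phi m \<noteq> 1")
    case False
    then have "G = of_nat (card (R \<inter> H))"
      using finR by (simp add: G_H sum.If_cases Int_def cong: if_cong)
    then show ?thesis by (intro exI[of _ "real (card (R \<inter> H))"]) simp
  next
    case True
    then obtain m where m: "m \<in> H" "phi m \<noteq> 1" by blast
    have "phi m * G = (\<Sum>k\<in>R. if (\<lambda>i. k i + m i) \<in> H then phi (\<lambda>i. k i + m i) else 0)"
      unfolding G_H sum_distrib_left using m(1)
      by (intro sum.cong refl) (simp add: H_add phi_add cis_multiple_2pi int)
    also have "\<dots> = G"
      unfolding G_H by (rule shift) (metis H_cong_iff phi_cong)
    finally have "G = 0" using m(2) by (rule sum_eq_0_by_invariance)
    then show ?thesis by auto
  qed
  then obtain r where r: "0 \<le> r" "G = of_real r" by blast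
  have gs: "gauss_sum (N i) = (\<Sum>k\<in>{0..<int (N i)}. cis (pi * (of_int (k * k) / real (N i))))" for i
    unfolding gauss_sum_def
    by (rule sum.reindex_bij_witness[of _ nat int]) (auto simp: power2_eq_square)
  have "G = (\<Prod>i\<in>UNIV. gauss_sum (N i))"
    unfolding G_def R_def gs by (subst prod_sum_PiE) (auto simp: phi_def B_def sum_distrib_left cis_sum)
  also have "\<dots> = (\<Prod>i\<in>UNIV. sqrt (N i) * cis (pi / 4))"
    using N by (intro prod.cong refl gauss_sum_even)
  also have "\<dots> = of_real (\<Prod>i\<in>UNIV. sqrt (N i)) * cis (CARD('n) * (pi / 4))"
    by (simp add: prod.distrib Complex.DeMoivre)
  finally have G: "G = of_real (\<Prod>i\<in>UNIV. sqrt (N i)) * cis (CARD('n) * (pi / 4))" .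
  define P where "P = (\<Prod>i\<in>UNIV. sqrt (N i))"
  have P: "0 < P" unfolding P_def using N by (intro prod_pos) auto
  have G: "of_real r = of_real P * cis (CARD('n) * (pi / 4))"
    using G r(2) by (simp only: P_def)
  then have "norm (of_real r :: complex) = norm (of_real P * cis (CARD('n) * (pi / 4)))" by simp
  \<comment> \<open>Equal absolute values leave only the unit factor, which must be 1; as
    \<open>P > 0\<close>, this excludes a vanishing sum as well.\<close>
  then have "r = P" using r P by (simp add: norm_mult)
  with G P have "cis (CARD('n) * (pi / 4)) = 1" by simp
  then have "cis (2 * pi * (CARD('n) / 8)) = 1" by (simp add: field_simps)
  then have "real CARD('n) / 8 \<in> \<int>" by (rule cis_2pi_eq_1D)
  then obtain m :: int where "real CARD('n) / 8 = of_int m" by (auto elim: Ints_cases)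
  then have "of_int (int CARD('n)) = (of_int (8 * m) :: real)" by simp
  then have "int CARD('n) = 8 * m" by (simp only: of_int_eq_iff)
  then have "int 8 dvd int CARD('n)" by simp
  then show ?thesis by (simp only: of_nat_dvd_iff)
qed

section \<open>Orthogonal families inside a self-dual lattice\<close>

context
  fixes L :: "'a::euclidean_space set"
  assumes int: "\<And>a b. a \<in> L \<Longrightarrow> b \<in> L \<Longrightarrow> a \<bullet> b \<in> \<int>"
    and dual: "\<And>a. (\<And>b. b \<in> L \<Longrightarrow> b \<bullet> b / 2 \<in> \<int> \<Longrightarrow> a \<bullet> b \<in> \<int>) \<Longrightarrow> a \<in> L"
    and span: "span L = UNIV"
begin

text \<open>Gram-Schmidt with cleared denominators. The projection of a lattice vector has rational
  coefficients whose denominators are norms of earlier vectors; multiplied by the product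
  \<open>D\<close> of these norms, the new vector pairs integrally with \<open>L\<close> and so lies
  in \<open>L\<close> by duality.\<close>

lemma orthogonal_vectors_in_lattice:
  assumes "m \<le> DIM('a)"
  shows "\<exists>B \<subseteq> L. finite B \<and> card B = m \<and> pairwise orthogonal B \<and> 0 \<notin> B"
  using assms
proof (induction m)
  case 0
  show ?case by (intro exI[of _ "{}"]) auto
next
  case (Suc m)
  then obtain B where B: "B \<subseteq> L" "finite B" "card B = m" "pairwise orthogonal B" "0 \<notin> B"
    by auto
  have "dim B \<le> m" using dim_le_card'[OF B(2)] B(3) by simp
  then have "span B \<noteq> UNIV" using Suc.prems by (metis dim_UNIV dim_span not_less_eq_eq)
  then have "\<not> L \<subseteq> span B" using span by (metis span_mono span_span top.extremum_uniqueI)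
  then obtain x where x: "x \<in> L" "x \<notin> span B" by blast
  define D where "D = (\<Prod>b\<in>B. b \<bullet> b)"
  define y where "y = x - (\<Sum>b\<in>B. (x \<bullet> b / (b \<bullet> b)) *\<^sub>R b)"
  have D0: "D \<noteq> 0" using B by (auto simp: D_def)
  have y0: "y \<noteq> 0"
  proof
    have "(\<Sum>b\<in>B. (x \<bullet> b / (b \<bullet> b)) *\<^sub>R b) \<in> span B"
      by (intro span_sum span_scale span_base)
    moreover assume "y = 0"
    ultimately show False using x(2) unfolding y_def right_minus_eq by argo
  qed
  have orth: "y \<bullet> c = 0" if "c \<in> B" for c
  proof -
    have "(\<Sum>b\<in>B. (x \<bullet> b / (b \<bullet> b)) * (b \<bullet> c)) = (\<Sum>b\<in>B. if b = c then x \<bullet> c else 0)"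
      using B(4,5) that by (intro sum.cong refl) (auto simp: pairwise_def orthogonal_def)
    then show ?thesis using B(2) that by (simp add: y_def inner_diff_left inner_sum_left)
  qed
  have DL: "D *\<^sub>R y \<in> L"
  proof (rule dual)
    fix c assume c: "c \<in> L"
    have "D * (\<Sum>b\<in>B. (x \<bullet> b / (b \<bullet> b)) * (b \<bullet> c)) = (\<Sum>b\<in>B. (\<Prod>b'\<in>B - {b}. b' \<bullet> b') * (x \<bullet> b) * (b \<bullet> c))"
      unfolding sum_distrib_left
    proof (intro sum.cong refl)
      fix b assume b: "b \<in> B"
      then have "D = b \<bullet> b * (\<Prod>b'\<in>B - {b}. b' \<bullet> b')" "b \<bullet> b \<noteq> 0"
        using B(2,5) by (auto simp: D_def prod.remove)
      then show "D * (x \<bullet> b / (b \<bullet> b) * (b \<bullet> c)) = (\<Prod>b'\<in>B - {b}. b' \<bullet> b') * (x \<bullet> b) * (b \<bullet> c)"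
        by simp
    qed
    moreover have "\<dots> \<in> \<int>"
      using B(1) x(1) c by (intro Ints_sum Ints_mult Ints_prod int) auto
    moreover have "D * (x \<bullet> c) \<in> \<int>"
      unfolding D_def using B(1) x(1) c by (intro Ints_mult Ints_prod int) auto
    ultimately show "(D *\<^sub>R y) \<bullet> c \<in> \<int>"
      by (simp add: y_def inner_diff_left inner_sum_left right_diff_distrib)
  qed
  have "D *\<^sub>R y \<notin> B" using orth[of "D *\<^sub>R y"] y0 D0 by auto
  then have "card (insert (D *\<^sub>R y) B) = Suc m" using B by simp
  moreover have "pairwise orthogonal (insert (D *\<^sub>R y) B)"
    using B(4) orth by (auto simp: pairwise_insert orthogonal_def inner_commute)
  ultimately show ?case
    using B DL D0 y0 by (intro exI[of _ "insert (D *\<^sub>R y) B"]) auto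
qed

end

text \<open>The hypotheses describe an even unimodular lattice, expressed through duality alone so
  that neither a lattice basis nor a determinant is needed. Coordinates come from an orthogonal
  family in \<open>L\<close>, which may generate only a sublattice.\<close>

theorem lattice_dim:
  fixes L :: "(real ^ 'n) set"
  assumes int: "\<And>a b. a \<in> L \<Longrightarrow> b \<in> L \<Longrightarrow> a \<bullet> b \<in> \<int>"
    and dual: "\<And>a. (\<And>b. b \<in> L \<Longrightarrow> b \<bullet> b / 2 \<in> \<int> \<Longrightarrow> a \<bullet> b \<in> \<int>) \<Longrightarrow> a \<in> L"
    and span: "span L = UNIV"
  shows "8 dvd CARD('n)"
proof -
  obtain C where C: "C \<subseteq> L" "finite C" "card C = CARD('n)" "pairwise orthogonal C" "0 \<notin> C"
    using orthogonal_vectors_in_lattice[OF int dual span order_refl] by (auto simp: DIM_cart)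
  obtain e where e: "bij_betw e (UNIV :: 'n set) C"
    using C by (metis finite_same_card_bij finite)
  \<comment> \<open>Doubling turns the norms into multiples of 4; the Gauss sum argument requires
    even ones.\<close>
  define b where "b i = 2 *\<^sub>R e i" for i
  have eL: "e i \<in> L" for i using e C(1) by (auto simp: bij_betw_def)
  have e_orth: "e i \<bullet> e j = 0" if "i \<noteq> j" for i j
    using that e C(4) unfolding bij_betw_def pairwise_def orthogonal_def inj_on_def by blast
  have b_orth: "b i \<bullet> b j = 0" if "i \<noteq> j" for i j using e_orth[OF that] by (simp add: b_def)
  have e0: "e i \<noteq> 0" for i using e C(5) by (metis bij_betwE UNIV_I)
  define N where "N i = nat \<lfloor>b i \<bullet> b i\<rfloor>" for i
  have bL: "b i \<in> L" for i
    by (rule dual) (simp add: b_def int eL)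
  have Nb: "real (N i) = b i \<bullet> b i" for i
    using int[OF bL bL, of i i] by (auto simp: N_def elim!: Ints_cases)
  have N: "even (N i)" "0 < N i" for i
  proof -
    obtain m :: int where m: "e i \<bullet> e i = of_int m" using int[OF eL eL, of i i] by (auto elim: Ints_cases)
    have "real (N i) = 4 * of_int m" unfolding Nb by (simp add: b_def m)
    then have "int (N i) = 4 * m" by linarith
    then show "even (N i)" by presburger
    have "0 < real (N i)" unfolding Nb using e0 by (simp add: b_def)
    then show "0 < N i" by simp
  qed
  \<comment> \<open>Inverse of the coordinate map
    \<open>x \<mapsto> (\<lambda>i. x \<bullet> b i)\<close>; its values form the dual of the
    lattice spanned by the \<open>b i\<close>, which contains \<open>L\<close>.\<close>
  define v where "v k = (\<Sum>i\<in>UNIV. (of_int (k i) / real (N i)) *\<^sub>R b i)" for k :: "'n \<Rightarrow> int"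
  have v_b: "v k \<bullet> b j = of_int (k j)" for k j
  proof -
    have "v k \<bullet> b j = (\<Sum>i\<in>UNIV. if i = j then of_int (k j) else 0)"
      unfolding v_def inner_sum_left using N(2)
      by (intro sum.cong refl) (auto simp: b_orth simp flip: Nb)
    then show ?thesis by simp
  qed
  have v_v: "v k \<bullet> v l = (\<Sum>i\<in>UNIV. of_int (k i * l i) / real (N i))" for k l
  proof -
    have "v k \<bullet> v l = (\<Sum>i\<in>UNIV. of_int (l i) / real (N i) * (v k \<bullet> b i))"
      by (subst (2) v_def) (simp add: inner_sum_right)
    then show ?thesis by (simp add: v_b mult.commute)
  qed
  have "independent C" using C(4,5) by (rule pairwise_orthogonal_independent)
  then have spanC: "span C = UNIV"
    using C by (intro dim_eq_full[THEN iffD1]) (simp add: dim_eq_card_independent DIM_cart)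
  have expand: "\<exists>l. x = v l" if "x \<in> L" for x
  proof
    define l where "l i = \<lfloor>x \<bullet> b i\<rfloor>" for i
    have l: "of_int (l i) = x \<bullet> b i" for i using int[OF that bL, of i] by (simp add: l_def)
    have "(x - v l) \<bullet> e i = 0" for i
    proof -
      have "(x - v l) \<bullet> b i = 0" by (simp add: inner_diff_left v_b l)
      then show ?thesis by (simp add: b_def)
    qed
    then have "orthogonal (x - v l) c" if "c \<in> C" for c
      using e that by (auto simp: bij_betw_def orthogonal_def)
    then have "orthogonal (x - v l) (x - v l)"
      using spanC by (metis orthogonal_to_span UNIV_I)
    then show "x = v l" by (simp add: orthogonal_def)
  qed
  define H where "H = {k. v k \<in> L}"
  show ?thesis
  proof (rule self_dual_even_part_dim[where N = N and H = H])
    show "(\<Sum>i\<in>UNIV. of_int (k i * l i) / real (N i)) \<in> \<int>" if "k \<in> H" "l \<in> H" for k l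
      using int that unfolding v_v[symmetric] by (auto simp: H_def)
    show "k \<in> H" if k: "\<And>l. l \<in> H \<Longrightarrow> (\<Sum>i\<in>UNIV. of_int (l i * l i) / real (N i)) / 2 \<in> \<int> \<Longrightarrow>
        (\<Sum>i\<in>UNIV. of_int (k i * l i) / real (N i)) \<in> \<int>" for k
      unfolding H_def mem_Collect_eq
    proof (rule dual)
      fix x assume x: "x \<in> L" "x \<bullet> x / 2 \<in> \<int>"
      then obtain l where "x = v l" using expand by blast
      then show "v k \<bullet> x \<in> \<int>" using k[of l] x unfolding v_v[symmetric] by (simp add: H_def)
    qed
  qed (use N in auto)
qed

section \<open>Moments of the sphere measure\<close>

text \<open>The rotation invariance of \<open>sphere_measure\<close> is only available for well-ordered index types; an
  isomorphic copy of the index type carries such an order.\<close>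

typedef 'n wellordered = "UNIV :: 'n set" ..

instance wellordered :: (finite) finite
proof
  have "range (Abs_wellordered :: 'a \<Rightarrow> _) = UNIV"
    by (metis surjI Rep_wellordered_inverse)
  then show "finite (UNIV :: 'a wellordered set)" by (metis finite finite_imageI)
qed

definition wellordered_index :: "'n::finite wellordered \<Rightarrow> nat" where
  "wellordered_index = (SOME f. inj f)"

lemma inj_wellordered_index: "inj (wellordered_index :: 'n::finite wellordered \<Rightarrow> nat)"
  unfolding wellordered_index_def
  using finite_imp_inj_to_nat_seg[of "UNIV :: 'n wellordered set"] by (metis finite someI_ex)

instantiation wellordered :: (finite) wellorder
begin

definition "x \<le> y \<longleftrightarrow> wellordered_index x \<le> wellordered_index y"
definition "x < y \<longleftrightarrow> wellordered_index x < wellordered_index y"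

instance
proof
  fix P :: "'a wellordered \<Rightarrow> bool" and a
  assume step: "\<And>x. (\<And>y. y < x \<Longrightarrow> P y) \<Longrightarrow> P x"
  show "P a"
    by (induction a rule: measure_induct_rule[of wellordered_index])
       (auto intro: step simp: less_wellordered_def)
qed (auto simp: less_eq_wellordered_def less_wellordered_def dest: injD[OF inj_wellordered_index])

end

definition relabel :: "real ^ 'n \<Rightarrow> real ^ 'n wellordered" where
  "relabel x = (\<chi> i. x $ Rep_wellordered i)"

lemma bij_Rep_wellordered: "bij Rep_wellordered"
  by (metis Abs_wellordered_inverse Rep_wellordered_inverse UNIV_I bijI')

lemma inner_relabel: "relabel x \<bullet> relabel y = x \<bullet> y"
  by (simp add: relabel_def inner_vec_def sum.reindex_bij_betw[OF bij_Rep_wellordered, of "\<lambda>i. x $ i * y $ i"])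

lemma norm_relabel: "norm (relabel x) = norm x"
  by (simp add: norm_eq_sqrt_inner inner_relabel)

lemma linear_relabel: "linear relabel"
  by (intro linearI) (simp_all add: relabel_def vec_eq_iff)

lemma borel_measurable_relabel [measurable]: "relabel \<in> borel_measurable borel"
  by (intro borel_measurable_continuous_onI linear_continuous_on)
     (simp add: linear_relabel linear_conv_bounded_linear[symmetric])

lemma distr_lborel_relabel:
  "distr lborel borel (relabel :: real ^ 'n \<Rightarrow> _) = lborel"
proof (rule lborel_eqI[symmetric])
  fix l u :: "real ^ 'n wellordered"
  assume le: "\<And>b. b \<in> Basis \<Longrightarrow> l \<bullet> b \<le> u \<bullet> b"
  have le': "l $ i \<le> u $ i" for i
    using le[of "axis i 1"] by (simp add: inner_axis)
  define l' u' where "l' = (\<chi> i. l $ Abs_wellordered i)" and "u' = (\<chi> i. u $ Abs_wellordered i)"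
  have "relabel -` box l u = box l' u'"
  proof (intro set_eqI iffI)
    fix x assume x: "x \<in> relabel -` box l u"
    show "x \<in> box l' u'"
      unfolding mem_box_cart
    proof
      fix i
      show "l' $ i < x $ i \<and> x $ i < u' $ i"
        using x[unfolded vimage_eq mem_box_cart, rule_format, of "Abs_wellordered i"]
        by (simp add: relabel_def l'_def u'_def Abs_wellordered_inverse)
    qed
  next
    fix x assume x: "x \<in> box l' u'"
    show "x \<in> relabel -` box l u"
      unfolding vimage_eq mem_box_cart
    proof
      fix i
      show "l $ i < relabel x $ i \<and> relabel x $ i < u $ i"
        using x[unfolded mem_box_cart, rule_format, of "Rep_wellordered i"]
        by (simp add: relabel_def l'_def u'_def Rep_wellordered_inverse)
    qed
  qed
  then have "emeasure (distr lborel borel relabel) (box l u) = emeasure lborel (box l' u')"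
    by (simp add: emeasure_distr)
  also have "\<dots> = (\<Prod>b\<in>Basis. (u' - l') \<bullet> b)"
    using le' by (intro emeasure_lborel_box) (auto simp: Basis_vec_def inner_axis l'_def u'_def)
  also have "(\<Prod>b\<in>Basis. (u' - l') \<bullet> b) = (\<Prod>i\<in>UNIV. u' $ i - l' $ i)"
    unfolding Basis_vec_def
    by (simp add: image_Union[symmetric] UNION_singleton_eq_range prod.reindex inj_on_def axis_eq_axis inner_axis)
  also have "\<dots> = (\<Prod>i\<in>UNIV. u $ i - l $ i)"
    by (subst prod.reindex_bij_betw[OF bij_Rep_wellordered, symmetric])
       (simp add: l'_def u'_def Rep_wellordered_inverse)
  also have "\<dots> = (\<Prod>b\<in>Basis. (u - l) \<bullet> b)"
    unfolding Basis_vec_def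
    by (simp add: image_Union[symmetric] UNION_singleton_eq_range prod.reindex inj_on_def axis_eq_axis inner_axis)
  finally show "emeasure (distr lborel borel relabel) (box l u) = (\<Prod>b\<in>Basis. (u - l) \<bullet> b)" .
qed simp

lemma distr_sphere_measure_relabel:
  "distr sphere_measure borel (relabel :: real ^ 'n \<Rightarrow> _) = sphere_measure"
proof (rule measure_eqI)
  show "sets (distr sphere_measure borel (relabel :: real ^ 'n \<Rightarrow> _)) = sets sphere_measure"
    by (simp add: sphere_measure_def)
next
  fix A :: "(real ^ 'n wellordered) set"
  assume "A \<in> sets (distr sphere_measure borel (relabel :: real ^ 'n \<Rightarrow> _))"
  then have A: "A \<in> sets borel" by simp
  have sA: "sgn -` A \<in> sets (borel :: (real ^ 'n wellordered) measure)"
    using measurable_sets[OF borel_measurable_sgn A] by simp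
  have rA: "relabel -` A \<in> sets (borel :: (real ^ 'n) measure)"
    using measurable_sets[OF borel_measurable_relabel A] by simp
  have rsA: "sgn -` relabel -` A \<in> sets (borel :: (real ^ 'n) measure)"
    using measurable_sets[OF borel_measurable_sgn rA] by simp
  have sgn: "sgn (relabel x) = relabel (sgn x)" for x :: "real ^ 'n"
    by (simp add: sgn_div_norm norm_relabel linear_cmul[OF linear_relabel])
  have eq: "emeasure lborel B = emeasure lborel (relabel -` B :: (real ^ 'n) set)" if "B \<in> sets borel" for B
    using that by (subst distr_lborel_relabel[symmetric]) (simp add: emeasure_distr)
  have "emeasure lborel (cball 0 1 \<inter> sgn -` A) = emeasure lborel (cball (0 :: real ^ 'n) 1 \<inter> sgn -` relabel -` A)"
    using sA by (subst eq) (auto simp: norm_relabel sgn intro!: arg_cong[of _ _ "emeasure lborel"])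
  moreover have "emeasure lborel (cball (0 :: real ^ 'n wellordered) 1) = emeasure lborel (cball (0 :: real ^ 'n) 1)"
    by (subst eq) (auto simp: norm_relabel intro!: arg_cong[of _ _ "emeasure lborel"])
  ultimately show "emeasure (distr sphere_measure borel (relabel :: real ^ 'n \<Rightarrow> _)) A = emeasure sphere_measure A"
    using A sA rA rsA by (simp add: sphere_measure_def emeasure_distr)
qed

text \<open>An orthogonal map takes one of two vectors of equal norm to the other. It is found on
  the relabelled space, where rotation invariance applies.\<close>

lemma integral_sphere_measure_inner_cong:
  fixes a b :: "real ^ 'n" and g :: "real \<Rightarrow> real"
  assumes "norm a = norm b" and g: "g \<in> borel_measurable borel"
  shows "(\<integral>x. g (a \<bullet> x) \<partial>sphere_measure) = (\<integral>x. g (b \<bullet> x) \<partial>sphere_measure)"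
proof -
  have m: "(\<lambda>x. g (c \<bullet> x)) \<in> borel_measurable borel" for c :: "real ^ 'm"
    using g by measurable
  have tr: "(\<integral>x. g (c \<bullet> x) \<partial>sphere_measure) = (\<integral>y. g (relabel c \<bullet> y) \<partial>sphere_measure)" for c :: "real ^ 'n"
    unfolding distr_sphere_measure_relabel[symmetric]
    by (subst integral_distr) (use m in \<open>auto simp: sphere_measure_def inner_relabel\<close>)
  obtain f where f: "orthogonal_transformation f" "f (relabel a) = relabel b"
    using orthogonal_transformation_exists[of "relabel a" "relabel b"] assms(1) by (auto simp: norm_relabel)
  have [measurable]: "f \<in> borel_measurable borel"
    using f(1) by (intro borel_measurable_continuous_onI linear_continuous_on)
      (simp add: linear_conv_bounded_linear[symmetric] orthogonal_transformation_linear)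
  have "(\<integral>y. g (relabel b \<bullet> y) \<partial>sphere_measure) = (\<integral>y. g (f (relabel a) \<bullet> f y) \<partial>sphere_measure)"
    unfolding f(2)[symmetric]
    by (subst distr_sphere_measure_orthogonal[OF f(1), symmetric], subst integral_distr)
       (use m in \<open>auto simp: sphere_measure_def\<close>)
  also have "\<dots> = (\<integral>y. g (relabel a \<bullet> y) \<partial>sphere_measure)"
    using f(1) by (simp add: orthogonal_transformation_def)
  finally show ?thesis by (simp add: tr)
qed

section \<open>Powers of linear forms and power sums over designs\<close>

lemma poly_fun_upto_monomial:
  assumes "(\<Sum>i\<in>UNIV. m i) \<le> t"
  shows "(\<lambda>x :: real ^ 'n. c * (\<Prod>i\<in>UNIV. (x $ i) ^ m i)) \<in> poly_fun_upto t"
proof -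
  have "c * (\<Prod>i\<in>UNIV. (x $ i) ^ m i) =
      (\<Sum>m' | (\<Sum>i\<in>UNIV. m' i) \<le> t. (if m' = m then c else 0) * (\<Prod>i\<in>UNIV. (x $ i) ^ m' i))" for x :: "real ^ 'n"
    using assms by (simp add: if_distrib[of "\<lambda>u. u * _"] sum.delta finite_exponents cong: if_cong)
  then show ?thesis
    unfolding poly_fun_upto_def by (intro CollectI exI[of _ "\<lambda>m'. if m' = m then c else 0"] ext)
qed

lemma poly_fun_upto_add:
  assumes "p \<in> poly_fun_upto t" "q \<in> poly_fun_upto t"
  shows "(\<lambda>x. p x + q x) \<in> poly_fun_upto t"
proof -
  obtain c c' where
    "p = (\<lambda>x. \<Sum>m | (\<Sum>i\<in>UNIV. m i) \<le> t. c m * (\<Prod>i\<in>UNIV. (x $ i) ^ m i))"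
    "q = (\<lambda>x. \<Sum>m | (\<Sum>i\<in>UNIV. m i) \<le> t. c' m * (\<Prod>i\<in>UNIV. (x $ i) ^ m i))"
    using assms by (auto simp: poly_fun_upto_def)
  then show ?thesis
    unfolding poly_fun_upto_def
    by (intro CollectI exI[of _ "\<lambda>m. c m + c' m"]) (simp add: distrib_right sum.distrib)
qed

lemma poly_fun_upto_zero: "(\<lambda>x. 0) \<in> poly_fun_upto t"
  unfolding poly_fun_upto_def by (intro CollectI exI[of _ "\<lambda>_. 0"]) simp

lemma poly_fun_upto_sum:
  assumes "\<And>i. i \<in> A \<Longrightarrow> p i \<in> poly_fun_upto t"
  shows "(\<lambda>x. \<Sum>i\<in>A. p i x) \<in> poly_fun_upto t"
  using assms by (induction A rule: infinite_finite_induct) (auto intro: poly_fun_upto_add poly_fun_upto_zero)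

lemma poly_fun_upto_mult_coord:
  assumes "p \<in> poly_fun_upto t"
  shows "(\<lambda>x :: real ^ 'n. a * x $ j * p x) \<in> poly_fun_upto (Suc t)"
proof -
  obtain c where c: "p = (\<lambda>x. \<Sum>m | (\<Sum>i\<in>UNIV. m i) \<le> t. c m * (\<Prod>i\<in>UNIV. (x $ i) ^ m i))"
    using assms by (auto simp: poly_fun_upto_def)
  have prod: "(\<Prod>i\<in>UNIV. (x $ i) ^ (m i + (if i = j then 1 else 0))) = x $ j * (\<Prod>i\<in>UNIV. (x $ i) ^ m i)"
    for x :: "real ^ 'n" and m
    by (simp add: power_add prod.distrib if_distrib[of "\<lambda>u. _ ^ u"] prod.delta mult.commute cong: if_cong)
  have "(\<lambda>x. a * x $ j * p x) = (\<lambda>x. \<Sum>m | (\<Sum>i\<in>UNIV. m i) \<le> t.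
      (a * c m) * (\<Prod>i\<in>UNIV. (x $ i) ^ (m i + (if i = j then 1 else 0))))"
    unfolding c prod by (simp add: sum_distrib_left mult_ac)
  also have "\<dots> \<in> poly_fun_upto (Suc t)"
    by (intro poly_fun_upto_sum poly_fun_upto_monomial) (simp add: sum.distrib)
  finally show ?thesis .
qed

lemma poly_fun_upto_Suc: "p \<in> poly_fun_upto t \<Longrightarrow> p \<in> poly_fun_upto (Suc t)"
proof -
  assume "p \<in> poly_fun_upto t"
  then obtain c where c: "p = (\<lambda>x. \<Sum>m | (\<Sum>i\<in>UNIV. m i) \<le> t. c m * (\<Prod>i\<in>UNIV. (x $ i) ^ m i))"
    by (auto simp: poly_fun_upto_def)
  show ?thesis unfolding c by (intro poly_fun_upto_sum poly_fun_upto_monomial) simp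
qed

lemma poly_fun_upto_inner_power:
  fixes a :: "real ^ 'n"
  assumes "k \<le> t"
  shows "(\<lambda>x. (a \<bullet> x) ^ k) \<in> poly_fun_upto t"
proof -
  have "(\<lambda>x. (a \<bullet> x) ^ k) \<in> poly_fun_upto k"
  proof (induction k)
    case 0
    show ?case using poly_fun_upto_monomial[of "\<lambda>_. 0" 0 1] by simp
  next
    case (Suc k)
    have "(\<lambda>x. (a \<bullet> x) ^ Suc k) = (\<lambda>x. \<Sum>j\<in>UNIV. a $ j * x $ j * (a \<bullet> x) ^ k)"
      by (simp add: inner_vec_def sum_distrib_right)
    also have "\<dots> \<in> poly_fun_upto (Suc k)"
      by (intro poly_fun_upto_sum poly_fun_upto_mult_coord Suc)
    finally show ?case .
  qed
  with assms show ?thesis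
    by (induction t rule: dec_induct) (auto intro: poly_fun_upto_Suc)
qed

text \<open>Homogeneity and rotation invariance reduce the sphere average to one fixed direction.
  The constant can stay unevaluated: the moment recursion determines it from \<open>card X\<close>,
  so no integral over the sphere is computed.\<close>

lemma spherical_design_power_sum:
  fixes X :: "(real ^ 'n) set"
  assumes "spherical_design t X" "k \<le> t"
  shows "\<exists>c. \<forall>a. (\<Sum>x\<in>X. (a \<bullet> x) ^ k) = c * norm a ^ k"
proof -
  let ?I = "\<lambda>a :: real ^ 'n. \<integral>x. (a \<bullet> x) ^ k \<partial>sphere_measure"
  let ?e = "axis undefined 1 :: real ^ 'n"
  have X: "finite X" "X \<noteq> {}" using assms by (auto simp: spherical_design_def)
  have "(\<Sum>x\<in>X. (a \<bullet> x) ^ k) = (real (card X) * ?I ?e) * norm a ^ k" for a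
  proof -
    have "(\<Sum>x\<in>X. (a \<bullet> x) ^ k) / real (card X) = ?I a"
      using assms poly_fun_upto_inner_power[of k t a] by (auto simp: spherical_design_def)
    also have "?I a = ?I (norm a *\<^sub>R ?e)"
      by (rule integral_sphere_measure_inner_cong) auto
    also have "\<dots> = norm a ^ k * ?I ?e"
      by (simp add: power_mult_distrib)
    finally show ?thesis using X by (simp add: field_simps)
  qed
  then show ?thesis by blast
qed

lemma spherical_design_odd_power_sum:
  fixes X :: "(real ^ 'n) set"
  assumes "spherical_design t X" "k \<le> t" "odd k"
  shows "(\<Sum>x\<in>X. (a \<bullet> x) ^ k) = 0"
proof -
  obtain c where c: "\<And>a. (\<Sum>x\<in>X. (a \<bullet> x) ^ k) = c * norm a ^ k"
    using spherical_design_power_sum[OF assms(1,2)] by blast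
  show ?thesis
    using c[of a] c[of "- a"] assms(3) by (simp add: sum_negf)
qed

text \<open>Comparing the coefficients of \<open>s\<^sup>2\<close> in the identity \<open>\<Sum>x\<in>X. (a \<bullet> x + s * (b \<bullet> x)) ^ (2 * k) = c * norm (a + s *\<^sub>R b) ^ (2 * k)\<close>
  and summing over an orthonormal basis of vectors \<open>b\<close> relates consecutive even moments, because \<open>X\<close> lies
  on the unit sphere.\<close>

lemma design_moment_recursion:
  fixes X :: "(real ^ 'n) set" and n :: real
  assumes X: "X \<subseteq> sphere 0 1" and n: "n = real CARD('n)"
    and c2: "\<And>a. (\<Sum>x\<in>X. (a \<bullet> x) ^ 2) = c2 * norm a ^ 2"
    and c4: "\<And>a. (\<Sum>x\<in>X. (a \<bullet> x) ^ 4) = c4 * norm a ^ 4"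
    and c6: "\<And>a. (\<Sum>x\<in>X. (a \<bullet> x) ^ 6) = c6 * norm a ^ 6"
  shows "n * c2 = card X" "(n + 2) * c4 = 3 * c2" "(n + 4) * c6 = 5 * c4"
proof -
  have norm_pow: "norm a ^ 2 = a \<bullet> a" "norm a ^ 4 = (a \<bullet> a)\<^sup>2" "norm a ^ 6 = (a \<bullet> a) ^ 3" for a :: "real ^ 'n"
    by (simp_all add: power2_norm_eq_inner[symmetric] power_mult[symmetric])
  have basis: "(\<Sum>i\<in>UNIV. (axis i 1 \<bullet> x)\<^sup>2) = 1" if "x \<in> X" for x
  proof -
    have "(\<Sum>i\<in>UNIV. (axis i 1 \<bullet> x)\<^sup>2) = x \<bullet> x"
      unfolding inner_axis' by (simp add: inner_vec_def power2_eq_square)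
    also have "\<dots> = 1" using that X by (auto simp flip: power2_norm_eq_inner)
    finally show ?thesis .
  qed
  have trace: "(\<Sum>i\<in>UNIV. \<Sum>x\<in>X. f x * (axis i 1 \<bullet> x)\<^sup>2) = (\<Sum>x\<in>X. f x)" for f :: "_ \<Rightarrow> real"
    by (subst sum.swap) (simp add: basis flip: sum_distrib_left)
  have "real (card X) = (\<Sum>i\<in>(UNIV :: 'n set). \<Sum>x\<in>X. (axis i 1 \<bullet> x)\<^sup>2)"
    using trace[of "\<lambda>_. 1"] by simp
  also have "\<dots> = n * c2" by (simp add: c2 n)
  finally show "n * c2 = card X" by simp
  define a where "a = (axis undefined 1 :: real ^ 'n)"
  have aa: "a \<bullet> a = 1" "norm a = 1" by (simp_all add: a_def)
  have ai: "(\<Sum>i\<in>UNIV. (a \<bullet> axis i 1)\<^sup>2) = 1"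
    unfolding a_def inner_axis by (simp add: axis_def if_distrib[of "\<lambda>u. u ^ 2"] sum.delta cong: if_cong)
  have sq: "(a + s *\<^sub>R b) \<bullet> (a + s *\<^sub>R b) = 1 + s\<^sup>2 + 2 * s * (a \<bullet> b)" if "b \<bullet> b = 1" for b s
    by (simp add: inner_add aa that power2_eq_square inner_commute[of b a] distrib_left)
  have s4: "6 * (\<Sum>x\<in>X. (a \<bullet> x)\<^sup>2 * (b \<bullet> x)\<^sup>2) = c4 * (2 + 4 * (a \<bullet> b)\<^sup>2)" if "b \<bullet> b = 1" for b
  proof -
    have "12 * (\<Sum>x\<in>X. (a \<bullet> x)\<^sup>2 * (b \<bullet> x)\<^sup>2)
      = (\<Sum>x\<in>X. ((a + b) \<bullet> x) ^ 4) + (\<Sum>x\<in>X. ((a - b) \<bullet> x) ^ 4)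
        - 2 * (\<Sum>x\<in>X. (a \<bullet> x) ^ 4) - 2 * (\<Sum>x\<in>X. (b \<bullet> x) ^ 4)"
      unfolding sum_distrib_left sum.distrib[symmetric] sum_subtractf[symmetric]
      by (intro sum.cong refl) (simp add: inner_add_left inner_diff_left, algebra)
    also have "\<dots> = c4 * (2 + 2 * (a \<bullet> b))\<^sup>2 + c4 * (2 - 2 * (a \<bullet> b))\<^sup>2 - 4 * c4"
      unfolding c4 norm_pow by (simp add: sq[OF that, of 1, simplified] sq[OF that, of "- 1", simplified] aa that)
    also have "\<dots> = 2 * (c4 * (2 + 4 * (a \<bullet> b)\<^sup>2))" by (simp add: power2_eq_square algebra_simps)
    finally show ?thesis by simp
  qed
  have "6 * c2 = (\<Sum>i\<in>UNIV. 6 * (\<Sum>x\<in>X. (a \<bullet> x)\<^sup>2 * (axis i 1 \<bullet> x)\<^sup>2))"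
    unfolding sum_distrib_left[symmetric] trace c2 by (simp add: aa)
  also have "\<dots> = (\<Sum>i\<in>UNIV. c4 * (2 + 4 * (a \<bullet> axis i 1)\<^sup>2))" by (intro sum.cong refl s4) simp
  also have "\<dots> = c4 * (2 * n + 4)" by (simp add: sum.distrib ai n flip: sum_distrib_left)
  finally show "(n + 2) * c4 = 3 * c2" by (simp add: algebra_simps)
  \<comment> \<open>The coefficient of \<open>s ^ 2\<close> is extracted from the values at
    \<open>s = 1, -1, 2, -2\<close>. The weights 16 and -1 cancel the terms in \<open>s ^ 4\<close>,
    and the last two sums remove those in \<open>s ^ 0\<close> and \<open>s ^ 6\<close>.\<close>
  have s6: "15 * (\<Sum>x\<in>X. (a \<bullet> x) ^ 4 * (b \<bullet> x)\<^sup>2) = c6 * (3 + 12 * (a \<bullet> b)\<^sup>2)" if "b \<bullet> b = 1" for b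
  proof -
    have "24 * (15 * (\<Sum>x\<in>X. (a \<bullet> x) ^ 4 * (b \<bullet> x)\<^sup>2))
      = 16 * ((\<Sum>x\<in>X. ((a + b) \<bullet> x) ^ 6) + (\<Sum>x\<in>X. ((a - b) \<bullet> x) ^ 6))
        - ((\<Sum>x\<in>X. ((a + 2 *\<^sub>R b) \<bullet> x) ^ 6) + (\<Sum>x\<in>X. ((a - 2 *\<^sub>R b) \<bullet> x) ^ 6))
        - 30 * (\<Sum>x\<in>X. (a \<bullet> x) ^ 6) + 96 * (\<Sum>x\<in>X. (b \<bullet> x) ^ 6)"
      unfolding sum_distrib_left sum.distrib[symmetric] sum_subtractf[symmetric]
      by (intro sum.cong refl) (simp add: inner_add_left inner_diff_left, algebra)
    also have "\<dots> = c6 * (16 * ((2 + 2 * (a \<bullet> b)) ^ 3 + (2 - 2 * (a \<bullet> b)) ^ 3)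
        - ((5 + 4 * (a \<bullet> b)) ^ 3 + (5 - 4 * (a \<bullet> b)) ^ 3) + 66)"
      unfolding c6 norm_pow
      by (simp add: sq[OF that, of 1, simplified] sq[OF that, of "- 1", simplified]
          sq[OF that, of 2, simplified] sq[OF that, of "- 2", simplified] aa that) algebra
    also have "\<dots> = 24 * (c6 * (3 + 12 * (a \<bullet> b)\<^sup>2))" by algebra
    finally show ?thesis by simp
  qed
  have "15 * c4 = (\<Sum>i\<in>UNIV. 15 * (\<Sum>x\<in>X. (a \<bullet> x) ^ 4 * (axis i 1 \<bullet> x)\<^sup>2))"
    unfolding sum_distrib_left[symmetric] trace c4 by (simp add: aa)
  also have "\<dots> = (\<Sum>i\<in>UNIV. c6 * (3 + 12 * (a \<bullet> axis i 1)\<^sup>2))" by (intro sum.cong refl s6) simp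
  also have "\<dots> = c6 * (3 * n + 12)" by (simp add: sum.distrib ai n flip: sum_distrib_left)
  finally show "(n + 4) * c6 = 5 * c4" by (simp add: algebra_simps)
qed

section \<open>Arithmetic of the design equations\<close>

lemma choose_three: "3 * (2 * ((n + 2) choose 3)) = n * (n + 1) * (n + 2)"
proof (induction n)
  case (Suc n)
  have "Suc n + 2 choose 3 = (n + 2 choose 2) + (n + 2 choose 3)"
    by (simp add: numeral_3_eq_3 numeral_2_eq_2)
  moreover have "2 * (n + 2 choose 2) = (n + 2) * (n + 1)"
    by (simp add: choose_two)
  ultimately have "3 * (2 * ((Suc n + 2) choose 3)) = 3 * ((n + 2) * (n + 1)) + n * (n + 1) * (n + 2)"
    using Suc by simp
  then show ?case by (simp add: algebra_simps)
qed simp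

text \<open>The cubic and quadratic factors form the product of the integers from
  \<open>s - 2\<close> to \<open>s + 2\<close>. The extra factor \<open>s\<close> gains a 3: if 3
  divides \<open>s\<close>, then \<open>s\<close> occurs twice, and otherwise two of the five
  integers are already multiples of 3.\<close>

lemma product_of_five_consecutive:
  fixes s :: int
  shows "120 dvd s * (s\<^sup>2 - 1) * (s\<^sup>2 - 4)" "360 dvd s * (s\<^sup>2 - 1) * (s\<^sup>2 - 4) * s"
proof -
  define P where "P = s * (s\<^sup>2 - 1) * (s\<^sup>2 - 4)"
  have P: "P = s * ((s - 1) * (s + 1)) * ((s - 2) * (s + 2))"
    unfolding P_def by (simp add: power2_eq_square algebra_simps)
  have "5 dvd s \<or> 5 dvd s - 1 \<or> 5 dvd s + 1 \<or> 5 dvd s - 2 \<or> 5 dvd s + 2" by presburger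
  then have 5: "5 dvd P" unfolding P by (elim disjE) (simp_all add: dvd_mult dvd_mult2)
  have 8: "8 dvd P"
  proof (cases "even s")
    case True
    then obtain t where "s = 2 * t" by blast
    then have "P = 8 * (t * ((2 * t - 1) * (2 * t + 1)) * ((t - 1) * (t + 1)))" unfolding P by (simp add: algebra_simps)
    then show ?thesis by simp
  next
    case False
    then obtain t where t: "s = 2 * t + 1" by (auto elim: oddE)
    have "2 dvd t * (t + 1)" by simp
    then obtain j where "t * (t + 1) = 2 * j" by blast
    then have "(s - 1) * (s + 1) = 8 * j" unfolding t by (simp add: algebra_simps)
    then show ?thesis unfolding P by (simp add: dvd_mult dvd_mult2)
  qed
  have 3: "3 dvd P \<and> 9 dvd P * s"
  proof -
    consider t where "s = 3 * t" | t where "s = 3 * t + 1" | t where "s = 3 * t - 1"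
    proof -
      have "s = 3 * (s div 3) \<or> s = 3 * (s div 3) + 1 \<or> s = 3 * (s div 3 + 1) - 1" by presburger
      then show thesis using that by blast
    qed
    then show ?thesis
    proof cases
      case 1
      have "P * s = s * s * ((s - 1) * (s + 1) * ((s - 2) * (s + 2)))" by (simp add: P mult_ac)
      also have "s * s = 9 * (t * t)" by (simp add: 1)
      finally show ?thesis by (simp add: P 1)
    next
      case 2
      have "P = (s - 1) * (s + 2) * (s * (s + 1) * (s - 2))" by (simp add: P mult_ac)
      also have "(s - 1) * (s + 2) = 9 * (t * (t + 1))" by (simp add: 2 algebra_simps)
      finally show ?thesis by simp
    next
      case 3
      have "P = (s + 1) * (s - 2) * (s * (s - 1) * (s + 2))" by (simp add: P mult_ac)
      also have "(s + 1) * (s - 2) = 9 * (t * (t - 1))" by (simp add: 3 algebra_simps)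
      finally show ?thesis by simp
    qed
  qed
  obtain a where a: "P = 3 * a" using 3 by blast
  obtain b where b: "P = 5 * b" using 5 by blast
  obtain c where c: "P = 8 * c" using 8 by blast
  obtain e where e: "P * s = 9 * e" using 3 by blast
  \<comment> \<open>Bezout coefficients: \<open>40 - 24 - 15 = 1\<close> here, and
    \<open>216 + 225 - 440 = 1\<close> for \<open>P * s\<close>.\<close>
  have "P = 120 * (a - b - c)" using a b c by simp
  moreover have "P * s = 360 * ((3 * b + 5 * c) * s - 11 * e)" using b c e by algebra
  ultimately have "120 dvd P" "360 dvd P * s" by (auto intro: dvdI)
  then show "120 dvd s * (s\<^sup>2 - 1) * (s\<^sup>2 - 4)" "360 dvd s * (s\<^sup>2 - 1) * (s\<^sup>2 - 4) * s"
    by (simp_all add: P_def)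
qed

lemma prime_power_dvd_mult_cancel:
  fixes p D u v :: int
  assumes "prime p" "p ^ m dvd D * u * v" "\<not> p dvd u" "\<not> p dvd v"
  shows "p ^ m dvd D"
proof -
  have "coprime (p ^ m) u" "coprime (p ^ m) v"
    using assms by (auto intro: prime_imp_coprime)
  then show ?thesis using assms(2) by (simp add: coprime_dvd_mult_left_iff)
qed

context
  fixes d :: nat
  assumes d2: "d \<ge> 2"
    and p5: "\<And>p :: nat. prime p \<Longrightarrow> p \<ge> 5 \<Longrightarrow> multiplicity p (d ^ 3 - d) \<le> 2"
    and p3: "multiplicity 3 (d ^ 3 - d) \<le> 4"
    and p2: "multiplicity 2 d \<in> {2, 3, 4}"
begin

lemma cube_minus_nonzero: "d ^ 3 - d \<noteq> 0"
proof -
  have "d ^ 1 < d ^ 3" using d2 by (intro power_strict_increasing) auto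
  then show ?thesis by simp
qed

lemma int_cube_minus: "int (d ^ 3 - d) = int d ^ 3 - int d"
proof -
  have "d ^ 1 \<le> d ^ 3" using d2 by (intro power_increasing) auto
  then show ?thesis by (simp add: of_nat_diff)
qed

lemma four_dvd: "4 dvd d"
proof -
  have "2 ^ 2 dvd d" using p2 by (intro multiplicity_dvd') auto
  then show ?thesis by simp
qed

lemma multiplicity_bound:
  fixes p :: nat
  assumes "prime p" "int p ^ Suc m dvd int d ^ 3 - int d"
  shows "m < multiplicity p (d ^ 3 - d)"
proof -
  have "p ^ Suc m dvd d ^ 3 - d"
    using assms(2) by (metis int_cube_minus of_nat_dvd_iff of_nat_power)
  then show ?thesis
    using assms(1) cube_minus_nonzero by (metis Suc_le_lessD multiplicity_geI not_prime_unit)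
qed

text \<open>As \<open>d\<close> is even, \<open>d ^ 2 - 1\<close> is odd, so the whole power of 2
  sits in \<open>d\<close>.\<close>

lemma not_32_dvd: "\<not> 32 dvd int d ^ 3 - int d"
proof
  assume "32 dvd int d ^ 3 - int d"
  moreover have "int d ^ 3 - int d = int d * (int d ^ 2 - 1)" by (simp add: power2_eq_square power3_eq_cube algebra_simps)
  ultimately have "2 ^ 5 dvd int d * (int d ^ 2 - 1)" by simp
  moreover have "coprime (2 ^ 5) (int d ^ 2 - 1)"
    unfolding coprime_power_left_iff coprime_left_2_iff_odd using four_dvd by auto
  ultimately have "2 ^ 5 dvd int d" by (metis coprime_dvd_mult_left_iff)
  then have "2 ^ 5 dvd d" by (metis of_nat_dvd_iff of_nat_numeral of_nat_power)
  then have "5 \<le> multiplicity 2 d" using d2 by (intro multiplicity_geI) auto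
  then show False using p2 by auto
qed

text \<open>For \<open>A = u / w\<close> in lowest terms the equation reads
  \<open>D * u * v = 720 * k * w ^ 3\<close> with \<open>D = d ^ 3 - d\<close> and \<open>v\<close>
  congruent to \<open>5 * u ^ 2\<close> modulo \<open>w\<close>. A prime \<open>p \<noteq> 5\<close>
  dividing \<open>w\<close> divides neither \<open>u\<close> nor \<open>v\<close>, so the power of
  \<open>p\<close> in \<open>720 * w ^ 3\<close> must divide \<open>D\<close>. This gives at least
  \<open>2 ^ 5\<close>, \<open>3 ^ 5\<close> or \<open>p ^ 3\<close>, against the
  hypotheses.\<close>

lemma norm_integral:
  fixes A :: real
  assumes "A \<in> \<rat>"
    and k: "(real d ^ 3 - real d) * A * (5 * A\<^sup>2 - 15 * real d * A + 12 * (real d)\<^sup>2 - 8) = 720 * of_int k"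
  shows "A \<in> \<int>"
proof -
  obtain u w :: int where uw: "w > 0" "coprime u w" "A = of_int u / of_int w"
    using assms(1) by (rule Rats_cases')
  let ?D = "int d ^ 3 - int d"
  let ?v = "5 * u\<^sup>2 - 15 * int d * u * w + (12 * (int d)\<^sup>2 - 8) * w\<^sup>2"
  have "of_int (?D * u * ?v) = (of_int (720 * k * w ^ 3) :: real)"
  proof -
    have u: "of_int u = A * of_int w" using uw by simp
    have "of_int (?D * u * ?v) = ((real d ^ 3 - real d) * A * (5 * A\<^sup>2 - 15 * real d * A + 12 * (real d)\<^sup>2 - 8)) * of_int w ^ 3"
      unfolding of_int_mult of_int_diff of_int_add of_int_power of_int_numeral of_int_of_nat_eq u by algebra
    then show ?thesis unfolding k by simp
  qed
  then have eq: "?D * u * ?v = 720 * k * w ^ 3" by (simp only: of_int_eq_iff)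
  have "w = 1"
  proof (rule ccontr)
    assume "w \<noteq> 1"
    then obtain p :: int where p: "prime p" "p dvd w"
      using uw(1) prime_divisor_exists[of w] by auto
    have pu: "\<not> p dvd u" using p uw(2) by (metis coprime_common_divisor not_prime_unit)
    then have pu2: "\<not> p dvd u\<^sup>2" using p(1) prime_dvd_power by blast
    obtain w' where w': "w = p * w'" using p(2) by blast
    then have wcube: "w ^ 3 = p ^ 3 * w' ^ 3" by (simp add: power_mult_distrib)
    obtain q :: nat where q: "p = int q" using p(1) prime_ge_0_int nonneg_int_cases by metis
    have qp: "prime q" using p(1) q by simp
    have "q \<ge> 2" using qp by (rule prime_ge_2_nat)
    moreover have "q \<noteq> 4" "q \<noteq> 6" using primes_dvd_imp_eq[OF two_is_prime_nat qp] by auto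
    ultimately consider "q = 2" | "q = 3" | "q = 5" | "q \<ge> 7" by linarith
    then show False
    proof cases
      case 1
      have "2 ^ 5 dvd ?D * u * ?v" unfolding eq wcube q 1 by simp
      moreover have "odd u" using pu q 1 by simp
      moreover have "odd ?v" using pu q 1 w' by simp
      ultimately have "2 ^ 5 dvd ?D" by (rule prime_power_dvd_mult_cancel[rotated]) simp
      then show False using not_32_dvd by simp
    next
      case 2
      have "?D * u * ?v = 3 ^ 5 * (80 * k * w' ^ 3)" unfolding eq wcube q 2 by simp
      then have "3 ^ 5 dvd ?D * u * ?v" by (rule dvdI)
      moreover have "\<not> 3 dvd u" using pu q 2 by simp
      moreover have "\<not> 3 dvd ?v"
      proof
        assume "3 dvd ?v"
        moreover have "?v = 5 * u\<^sup>2 + 3 * (- 15 * int d * u * w' + (12 * (int d)\<^sup>2 - 8) * 3 * w'\<^sup>2)"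
          unfolding w' q 2 by (simp add: power2_eq_square algebra_simps)
        ultimately have "3 dvd 5 * u\<^sup>2" by (metis dvd_add_left_iff dvd_triv_left)
        moreover have "\<not> 3 dvd u\<^sup>2" using pu2 q 2 by simp
        ultimately show False by presburger
      qed
      ultimately have "3 ^ 5 dvd ?D" by (rule prime_power_dvd_mult_cancel[rotated]) simp
      then show False using multiplicity_bound[of 3 4] p3 by simp
    next
      case 3
      \<comment> \<open>At \<open>p = 5\<close> the cofactor \<open>?v\<close> is itself divisible
        by 5. This factor cancels the 5 in 720, and the remaining \<open>?v'\<close> is prime to
        5.\<close>
      let ?v' = "u\<^sup>2 - 15 * int d * u * w' + 5 * (12 * (int d)\<^sup>2 - 8) * w'\<^sup>2"
      have "5 * (?D * u * ?v') = ?D * u * ?v" unfolding w' q 3 by (simp add: power2_eq_square algebra_simps)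
      also have "\<dots> = 5 * (5 ^ 3 * (144 * k * w' ^ 3))" unfolding eq wcube q 3 by simp
      finally have "?D * u * ?v' = 5 ^ 3 * (144 * k * w' ^ 3)" unfolding mult_cancel_left by simp
      then have "5 ^ 3 dvd ?D * u * ?v'" by (rule dvdI)
      moreover have "\<not> 5 dvd u" using pu q 3 by simp
      moreover have "\<not> 5 dvd ?v'"
      proof
        assume "5 dvd ?v'"
        moreover have "?v' = u\<^sup>2 + 5 * (- 3 * int d * u * w' + (12 * (int d)\<^sup>2 - 8) * w'\<^sup>2)" by (simp add: algebra_simps)
        ultimately have "5 dvd u\<^sup>2" by (metis dvd_add_left_iff dvd_triv_left)
        then show False using pu2 q 3 by simp
      qed
      ultimately have "5 ^ 3 dvd ?D" by (rule prime_power_dvd_mult_cancel[rotated]) simp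
      then show False using multiplicity_bound[of 5 2] p5[of 5] by simp
    next
      case 4
      have "p ^ 3 dvd ?D * u * ?v" unfolding eq wcube by simp
      moreover have "\<not> p dvd ?v"
      proof
        assume "p dvd ?v"
        moreover have "?v = 5 * u\<^sup>2 + p * (- 15 * int d * u * w' + (12 * (int d)\<^sup>2 - 8) * p * w'\<^sup>2)"
          unfolding w' by (simp add: power2_eq_square algebra_simps)
        ultimately have "p dvd 5 * u\<^sup>2" by (metis dvd_add_left_iff dvd_triv_left)
        then have "p dvd 5" using pu2 p(1) by (simp add: prime_dvd_mult_iff)
        then show False using zdvd_imp_le[of p 5] q 4 by simp
      qed
      ultimately have "p ^ 3 dvd ?D" using p(1) pu by (metis prime_power_dvd_mult_cancel)
      then have "int q ^ Suc 2 dvd ?D" by (simp only: q eval_nat_numeral)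
      then show False using multiplicity_bound[of q 2] p5[of q] qp 4 by simp
    qed
  qed
  then show ?thesis using uw by simp
qed

text \<open>For odd \<open>A\<close> and even \<open>d\<close> the cofactor is odd. If
  \<open>2 * c\<close> were odd too, the factor \<open>2 ^ 5\<close> of \<open>480 = 2 * 240\<close>
  would have to divide \<open>d ^ 3 - d\<close>; here the upper bound on the 2-adic valuation of
  \<open>d\<close> is used in full.\<close>

lemma inner_integral:
  fixes c A :: real
  assumes A: "A = of_int a" "odd a" and c: "2 * c \<in> \<int>"
    and k: "(real d ^ 3 - real d) * c * (5 * A\<^sup>2 - 15 * real d * A + 12 * (real d)\<^sup>2 - 8) = 240 * of_int k"
  shows "c \<in> \<int>"
proof -
  obtain m where m: "2 * c = of_int m" using c by (auto elim: Ints_cases)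
  let ?v = "5 * a\<^sup>2 - 15 * int d * a + 12 * (int d)\<^sup>2 - 8"
  have "of_int ((int d ^ 3 - int d) * m * ?v) = (of_int (480 * k) :: real)"
  proof -
    have "of_int ((int d ^ 3 - int d) * m * ?v)
      = 2 * ((real d ^ 3 - real d) * c * (5 * A\<^sup>2 - 15 * real d * A + 12 * (real d)\<^sup>2 - 8))"
      by (simp add: A flip: m)
    then show ?thesis unfolding k by simp
  qed
  then have eq: "(int d ^ 3 - int d) * m * ?v = 480 * k" by (simp only: of_int_eq_iff)
  have "even m"
  proof (rule ccontr)
    assume "odd m"
    have "2 ^ 5 dvd (int d ^ 3 - int d) * m * ?v" unfolding eq by simp
    moreover note \<open>odd m\<close>
    moreover have "odd ?v" using A four_dvd by auto
    ultimately have "2 ^ 5 dvd int d ^ 3 - int d" by (rule prime_power_dvd_mult_cancel[rotated]) simp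
    then show False using not_32_dvd by simp
  qed
  then obtain j where "m = 2 * j" by blast
  then have "c = of_int j" using m by simp
  then show ?thesis by simp
qed

end

section \<open>Tight designs\<close>

text \<open>Antipodal points contribute equally and are distinct away from 0, so a divisor of every
  summand counts twice. This is the source of the moduli 240 and 720.\<close>

lemma sum_even_function_dvd:
  fixes f :: "'a::real_vector \<Rightarrow> int"
  assumes "finite X" "\<And>x. x \<in> X \<Longrightarrow> - x \<in> X" "0 \<notin> X"
    and "\<And>x. x \<in> X \<Longrightarrow> f (- x) = f x" "\<And>x. x \<in> X \<Longrightarrow> m dvd f x"
  shows "2 * m dvd (\<Sum>x\<in>X. f x)"
  using assms
proof (induction "card X" arbitrary: X rule: less_induct)
  case less
  show ?case
  proof (cases "X = {}")
    case False
    then obtain x where x: "x \<in> X" by blast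
    have ne: "x \<noteq> - x"
    proof
      assume "x = - x"
      then have "2 *\<^sub>R x = 0" by (metis add.right_inverse scaleR_2)
      then show False using x less.prems(3) by simp
    qed
    let ?Y = "X - {x, - x}"
    have "2 * m dvd (\<Sum>x\<in>?Y. f x)"
    proof (rule less.hyps)
      show "card ?Y < card X" using less.prems(1) x by (intro psubset_card_mono) auto
    qed (use less.prems in auto)
    moreover have "(\<Sum>x\<in>X. f x) = (\<Sum>x\<in>?Y. f x) + (\<Sum>x\<in>{x, - x}. f x)"
      using less.prems(1,2) x by (intro sum.subset_diff) auto
    moreover have "(\<Sum>x\<in>{x, - x}. f x) = 2 * f x"
      using ne less.prems(4) x by simp
    ultimately show ?thesis using less.prems(5) x by simp
  qed simp
qed

definition design_dual :: "(real ^ 'n) set \<Rightarrow> nat \<Rightarrow> (real ^ 'n) set" where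
  "design_dual X d = {a. \<forall>x\<in>X. sqrt d * (a \<bullet> x) \<in> \<int>}"

lemma design_dual_add: "a \<in> design_dual X d \<Longrightarrow> b \<in> design_dual X d \<Longrightarrow> a + b \<in> design_dual X d"
  by (simp add: design_dual_def inner_add_left distrib_left)

section \<open>Power sums, inner products and antipodality of a tight design\<close>

context
  fixes X :: "(real ^ 'n) set" and d :: nat
  assumes tight: "tight_spherical_7_design X"
    and d2: "d \<ge> 2"
    and n: "CARD('n) = 3 * d ^ 2 - 4"
begin

lemma tight_real_dim: "real CARD('n) = 3 * (real d)\<^sup>2 - 4"
proof -
  have "2 ^ 2 \<le> d ^ 2" using d2 by (intro power_mono) auto
  then show ?thesis by (simp add: n of_nat_diff)
qed

lemma tight_d_gt_1: "1 < real d" "1 < (real d)\<^sup>2"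
  using d2 by auto

lemma tight_design: "spherical_design 7 X" "finite X" "X \<subseteq> sphere 0 1"
  using tight by (auto simp: tight_spherical_7_design_def spherical_design_def)

lemma tight_unit: "x \<in> X \<Longrightarrow> x \<bullet> x = 1"
  using tight_design(3) by (auto simp flip: power2_norm_eq_inner)

text \<open>With \<open>n = 3 * d ^ 2 - 4\<close> one has \<open>n + 1 = 3 * (d ^ 2 - 1)\<close>,
  \<open>n + 2 = 3 * d ^ 2 - 2\<close> and \<open>n + 4 = 3 * d ^ 2\<close>. The recursion started
  at \<open>card X = n * (n + 1) * (n + 2) / 3\<close> gives the constants
  \<open>(n + 1) * (n + 2) / 3\<close>, \<open>n + 1\<close> and
  \<open>5 * (n + 1) / (n + 4)\<close>.\<close>

lemma tight_power_sums:
  shows "(\<Sum>x\<in>X. (a \<bullet> x) ^ 2) = ((real d)\<^sup>2 - 1) * (3 * (real d)\<^sup>2 - 2) * (a \<bullet> a)"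
    and "(\<Sum>x\<in>X. (a \<bullet> x) ^ 4) = 3 * ((real d)\<^sup>2 - 1) * (a \<bullet> a) ^ 2"
    and "(\<Sum>x\<in>X. (a \<bullet> x) ^ 6) = 5 * ((real d)\<^sup>2 - 1) / (real d)\<^sup>2 * (a \<bullet> a) ^ 3"
proof -
  let ?n = "3 * (real d)\<^sup>2 - 4"
  obtain c2 where c2: "\<And>a. (\<Sum>x\<in>X. (a \<bullet> x) ^ 2) = c2 * norm a ^ 2"
    using spherical_design_power_sum[OF tight_design(1), of 2] by auto
  obtain c4 where c4: "\<And>a. (\<Sum>x\<in>X. (a \<bullet> x) ^ 4) = c4 * norm a ^ 4"
    using spherical_design_power_sum[OF tight_design(1), of 4] by auto
  obtain c6 where c6: "\<And>a. (\<Sum>x\<in>X. (a \<bullet> x) ^ 6) = c6 * norm a ^ 6"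
    using spherical_design_power_sum[OF tight_design(1), of 6] by auto
  have c: "?n * c2 = card X" "(?n + 2) * c4 = 3 * c2" "(?n + 4) * c6 = 5 * c4"
    using design_moment_recursion[OF tight_design(3) tight_real_dim[symmetric] c2 c4 c6] by auto
  have "3 * card X = CARD('n) * (CARD('n) + 1) * (CARD('n) + 2)"
    using tight choose_three[of "CARD('n)"] by (simp add: tight_spherical_7_design_def)
  from arg_cong[OF this, of real]
  have cX: "3 * real (card X) = ?n * (?n + 1) * (?n + 2)" by (simp only: of_nat_mult of_nat_add tight_real_dim of_nat_numeral of_nat_1)
  have n0: "?n > 0"
  proof -
    have "2 ^ 2 \<le> (real d)\<^sup>2" using d2 by (intro power_mono) auto
    then show ?thesis by simp
  qed
  have "?n * (3 * c2) = 3 * (?n * c2)" by simp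
  also have "\<dots> = ?n * ((?n + 1) * (?n + 2))" unfolding c(1) cX by (simp only: mult.assoc)
  finally have c2v: "3 * c2 = (?n + 1) * (?n + 2)" using n0 by (metis less_irrefl mult_left_cancel)
  have "(?n + 2) * c4 = (?n + 2) * (?n + 1)" unfolding c(2) c2v by (simp only: mult.commute)
  moreover have "?n + 2 \<noteq> 0" using n0 by linarith
  ultimately have c4v: "c4 = ?n + 1" by (metis mult_left_cancel)
  have norm_pow: "norm a ^ 2 = a \<bullet> a" "norm a ^ 4 = (a \<bullet> a)\<^sup>2" "norm a ^ 6 = (a \<bullet> a) ^ 3"
    by (simp_all add: power2_norm_eq_inner[symmetric] power_mult[symmetric])
  have "c2 = ((real d)\<^sup>2 - 1) * (3 * (real d)\<^sup>2 - 2)" using c2v by algebra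
  then show "(\<Sum>x\<in>X. (a \<bullet> x) ^ 2) = ((real d)\<^sup>2 - 1) * (3 * (real d)\<^sup>2 - 2) * (a \<bullet> a)"
    by (simp add: c2 norm_pow)
  show "(\<Sum>x\<in>X. (a \<bullet> x) ^ 4) = 3 * ((real d)\<^sup>2 - 1) * (a \<bullet> a) ^ 2"
    unfolding c4 norm_pow c4v by algebra
  have "c6 = 5 * ((real d)\<^sup>2 - 1) / (real d)\<^sup>2" 
  proof -
    have "c6 * (real d)\<^sup>2 = 5 * ((real d)\<^sup>2 - 1)" using c(3) c4v by algebra
    then show ?thesis using d2 by (intro eq_divide_imp) auto
  qed
  then show "(\<Sum>x\<in>X. (a \<bullet> x) ^ 6) = 5 * ((real d)\<^sup>2 - 1) / (real d)\<^sup>2 * (a \<bullet> a) ^ 3"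
    by (simp add: c6 norm_pow)
qed

text \<open>Equality case of Delsarte's linear programming bound for the test polynomial
  \<open>(t + 1) t\<^sup>2 (t\<^sup>2 - 1 / d\<^sup>2)\<^sup>2\<close>, which is nonnegative on \<open>[-1, 1]\<close>.\<close>

lemma tight_inner_products:
  assumes "x \<in> X" "y \<in> X" "x \<noteq> y"
  shows "x \<bullet> y = - 1 \<or> x \<bullet> y = 0 \<or> (x \<bullet> y)\<^sup>2 = 1 / (real d)\<^sup>2"
proof -
  define e where "e = 1 / (real d)\<^sup>2"
  define F where "F t = (t + 1) * (t * (t\<^sup>2 - e))\<^sup>2" for t :: real
  have F: "F t = t ^ 7 + t ^ 6 - 2 * e * t ^ 5 - 2 * e * t ^ 4 + e\<^sup>2 * t ^ 3 + e\<^sup>2 * t ^ 2" for t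
    unfolding F_def by algebra
  have odd: "(\<Sum>y\<in>X. (x \<bullet> y) ^ k) = 0" if "k \<le> 7" "odd k" for k
    using spherical_design_odd_power_sum[OF tight_design(1) that] by simp
  have ed: "e * (real d)\<^sup>2 = 1" using tight_d_gt_1 by (simp add: e_def)
  have "(\<Sum>y\<in>X. F (x \<bullet> y)) = (\<Sum>y\<in>X. (x \<bullet> y) ^ 6) - 2 * e * (\<Sum>y\<in>X. (x \<bullet> y) ^ 4) + e\<^sup>2 * (\<Sum>y\<in>X. (x \<bullet> y) ^ 2)"
    unfolding F by (simp add: sum.distrib sum_subtractf odd flip: sum_distrib_left)
  also have "\<dots> = 5 * ((real d)\<^sup>2 - 1) * e - 2 * e * (3 * ((real d)\<^sup>2 - 1))
      + e\<^sup>2 * (((real d)\<^sup>2 - 1) * (3 * (real d)\<^sup>2 - 2))"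
    unfolding tight_power_sums tight_unit[OF assms(1)] by (simp add: e_def)
  \<comment> \<open>Both sides equal \<open>2 * (1 - e) ^ 2\<close>. The term \<open>y = x\<close>
    thus exhausts the sum, and the other terms, being nonnegative, all vanish.\<close>
  also have "\<dots> = F 1" unfolding F power_one mult_1_right using ed by algebra
  finally have "(\<Sum>y\<in>X. F (x \<bullet> y)) = F (x \<bullet> x)" using tight_unit[OF assms(1)] by simp
  moreover have "(\<Sum>y\<in>X. F (x \<bullet> y)) = F (x \<bullet> x) + (\<Sum>y\<in>X - {x}. F (x \<bullet> y))"
    using assms tight_design(2) by (simp add: sum.remove)
  ultimately have "(\<Sum>y\<in>X - {x}. F (x \<bullet> y)) = 0" by simp
  moreover have "0 \<le> F (x \<bullet> y)" if "y \<in> X" for y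
  proof -
    have "\<bar>x \<bullet> y\<bar> \<le> norm x * norm y" by (rule Cauchy_Schwarz_ineq2)
    also have "\<dots> = 1" using tight_unit[OF assms(1)] tight_unit[OF that] by (simp add: norm_eq_1[symmetric])
    finally show ?thesis by (simp add: F_def)
  qed
  ultimately have "F (x \<bullet> y) = 0"
    using assms tight_design(2) by (subst (asm) sum_nonneg_eq_0_iff) auto
  then show ?thesis by (auto simp: F_def e_def)
qed

text \<open>The odd polynomial \<open>t ^ 3 - e * t\<close> sums to 0 over \<open>X\<close> and
  vanishes at every admissible inner product except 1 and -1. Without \<open>- x\<close> in
  \<open>X\<close> only the term \<open>1 - e > 0\<close> at \<open>y = x\<close> would
  survive.\<close>

lemma tight_antipodal:
  assumes "x \<in> X"
  shows "- x \<in> X"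
proof (rule ccontr)
  assume neg: "- x \<notin> X"
  define e where "e = 1 / (real d)\<^sup>2"
  have e: "e < 1" using tight_d_gt_1 by (simp add: e_def)
  have odd: "(\<Sum>y\<in>X. (x \<bullet> y) ^ k) = 0" if "k \<le> 7" "odd k" for k
    using spherical_design_odd_power_sum[OF tight_design(1) that] by simp
  have z: "(x \<bullet> y) ^ 3 - e * (x \<bullet> y) ^ 1 = 0" if "y \<in> X - {x}" for y
  proof -
    have "x \<bullet> y \<noteq> - 1"
    proof
      assume "x \<bullet> y = - 1"
      then have "(x + y) \<bullet> (x + y) = 0"
        using tight_unit[of x] tight_unit[of y] assms that by (simp add: inner_add inner_commute)
      then have "x + y = 0" by simp
      then have "- x = y" by (rule minus_unique)
      then show False using neg that by simp
    qed
    then have "x \<bullet> y = 0 \<or> (x \<bullet> y)\<^sup>2 = e"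
      using tight_inner_products[OF assms, of y] that by (auto simp: e_def)
    then show ?thesis by (auto simp: power3_eq_cube power2_eq_square)
  qed
  have "0 = (\<Sum>y\<in>X. (x \<bullet> y) ^ 3 - e * (x \<bullet> y) ^ 1)"
    unfolding sum_subtractf sum_distrib_left[symmetric] using odd[of 3] odd[of 1] by simp
  also have "\<dots> = (x \<bullet> x) ^ 3 - e * (x \<bullet> x) ^ 1"
    using assms tight_design(2) z by (subst sum.remove[of _ x]) auto
  also have "\<dots> = 1 - e" using tight_unit[OF assms] by simp
  finally show False using e by simp
qed

lemma tight_scaled_inner_integral:
  assumes "x \<in> X" "y \<in> X"
  shows "real d * (x \<bullet> y) \<in> \<int>"
proof (cases "x = y")
  case True
  then show ?thesis using tight_unit assms by simp
next
  case False
  consider "x \<bullet> y = - 1" | "x \<bullet> y = 0" | "(x \<bullet> y)\<^sup>2 = 1 / (real d)\<^sup>2"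
    using tight_inner_products[OF assms False] by blast
  then show ?thesis
  proof cases
    case 3
    then have "(real d * (x \<bullet> y))\<^sup>2 = 1" using tight_d_gt_1 by (simp add: power_mult_distrib)
    then have "real d * (x \<bullet> y) = 1 \<or> real d * (x \<bullet> y) = - 1" by (simp add: power2_eq_1_iff)
    then show ?thesis by auto
  qed auto
qed

text \<open>Derivatives at \<open>s = 0\<close> of the power sum identities along the line
  \<open>a + s *\<^sub>R b\<close>.\<close>

lemma tight_polarized_power_sums:
  shows "(\<Sum>x\<in>X. (a \<bullet> x) * (b \<bullet> x)) = ((real d)\<^sup>2 - 1) * (3 * (real d)\<^sup>2 - 2) * (a \<bullet> b)"
    and "(\<Sum>x\<in>X. (a \<bullet> x) ^ 3 * (b \<bullet> x)) = 3 * ((real d)\<^sup>2 - 1) * (a \<bullet> a) * (a \<bullet> b)"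
    and "(\<Sum>x\<in>X. (a \<bullet> x) ^ 5 * (b \<bullet> x)) = 5 * ((real d)\<^sup>2 - 1) / (real d)\<^sup>2 * (a \<bullet> a)\<^sup>2 * (a \<bullet> b)"
proof -
  have dl: "((\<lambda>s. \<Sum>x\<in>X. ((a + s *\<^sub>R b) \<bullet> x) ^ Suc k) has_real_derivative
      (\<Sum>x\<in>X. real (Suc k) * ((a \<bullet> x) ^ k * (b \<bullet> x)))) (at 0)" for k
    unfolding inner_add_left inner_scaleR_left
    by (rule derivative_eq_intros refl | simp add: mult_ac)+
  have dr: "((\<lambda>s. C * ((a + s *\<^sub>R b) \<bullet> (a + s *\<^sub>R b)) ^ k) has_real_derivative
      C * (real k * (2 * (a \<bullet> b)) * (a \<bullet> a) ^ (k - 1))) (at 0)" for k C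
    unfolding inner_add_left inner_add_right inner_scaleR_left inner_scaleR_right
    by (rule derivative_eq_intros refl | simp add: inner_commute)+
  have eq: "real (Suc k) * (\<Sum>x\<in>X. (a \<bullet> x) ^ k * (b \<bullet> x)) = C * (real j * (2 * (a \<bullet> b)) * (a \<bullet> a) ^ (j - 1))"
    if "\<And>a. (\<Sum>x\<in>X. (a \<bullet> x) ^ Suc k) = C * (a \<bullet> a) ^ j" for k j C
    using dl[of k] dr[of C j] unfolding that sum_distrib_left[symmetric] by (rule DERIV_unique)
  show "(\<Sum>x\<in>X. (a \<bullet> x) * (b \<bullet> x)) = ((real d)\<^sup>2 - 1) * (3 * (real d)\<^sup>2 - 2) * (a \<bullet> b)"
  proof -
    define C where "C = ((real d)\<^sup>2 - 1) * (3 * (real d)\<^sup>2 - 2)"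
    have "(\<Sum>x\<in>X. (a \<bullet> x) ^ Suc 1) = C * (a \<bullet> a) ^ 1" for a
      using tight_power_sums(1)[of a] by (simp only: C_def Suc_1 power_one_right)
    from eq[OF this] show ?thesis unfolding C_def[symmetric] by simp
  qed
  show "(\<Sum>x\<in>X. (a \<bullet> x) ^ 3 * (b \<bullet> x)) = 3 * ((real d)\<^sup>2 - 1) * (a \<bullet> a) * (a \<bullet> b)"
  proof -
    define C where "C = 3 * ((real d)\<^sup>2 - 1)"
    have "(\<Sum>x\<in>X. (a \<bullet> x) ^ Suc 3) = C * (a \<bullet> a) ^ 2" for a
      using tight_power_sums(2)[of a] by (simp add: C_def)
    from eq[OF this] show ?thesis unfolding C_def[symmetric] by simp
  qed
  show "(\<Sum>x\<in>X. (a \<bullet> x) ^ 5 * (b \<bullet> x)) = 5 * ((real d)\<^sup>2 - 1) / (real d)\<^sup>2 * (a \<bullet> a)\<^sup>2 * (a \<bullet> b)"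
  proof -
    define C where "C = 5 * ((real d)\<^sup>2 - 1) / (real d)\<^sup>2"
    have "(\<Sum>x\<in>X. (a \<bullet> x) ^ Suc 5) = C * (a \<bullet> a) ^ 3" for a
      using tight_power_sums(3)[of a] by (simp add: C_def)
    from eq[OF this] show ?thesis unfolding C_def[symmetric] by simp
  qed
qed

text \<open>The coefficients 5, -15 and \<open>12 * d ^ 2 - 8\<close> arise by inserting the
  polarized power sums into \<open>s ^ 5 * t - 5 * s ^ 3 * t + 4 * s * t\<close>, an expansion of
  the product of five consecutive integers times \<open>t\<close>. The first claim serves to make
  \<open>a \<bullet> a\<close> rational, so that its denominator can be examined.\<close>

lemma design_dual_sums:
  assumes "a \<in> design_dual X d" "b \<in> design_dual X d"
  shows "\<exists>k. (real d ^ 3 - real d) * (3 * (real d)\<^sup>2 - 2) * (a \<bullet> b) = of_int k"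
    and "\<exists>k. (real d ^ 3 - real d) * (a \<bullet> b) * (5 * (a \<bullet> a)\<^sup>2 - 15 * real d * (a \<bullet> a) + 12 * (real d)\<^sup>2 - 8) = 240 * of_int k"
    and "a = b \<Longrightarrow> \<exists>k. (real d ^ 3 - real d) * (a \<bullet> a) * (5 * (a \<bullet> a)\<^sup>2 - 15 * real d * (a \<bullet> a) + 12 * (real d)\<^sup>2 - 8) = 720 * of_int k"
proof -
  define s where "s x = \<lfloor>sqrt d * (a \<bullet> x)\<rfloor>" for x
  define t where "t x = \<lfloor>sqrt d * (b \<bullet> x)\<rfloor>" for x
  define r where "r = sqrt d"
  have s: "of_int (s x) = r * (a \<bullet> x)" if "x \<in> X" for x
    using assms(1) that by (simp add: design_dual_def s_def r_def)
  have t: "of_int (t x) = r * (b \<bullet> x)" if "x \<in> X" for x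
    using assms(2) that by (simp add: design_dual_def t_def r_def)
  have neg: "s (- x) = - s x" "t (- x) = - t x" if "x \<in> X" for x
  proof -
    have "real_of_int (s (- x)) = real_of_int (- s x)" "real_of_int (t (- x)) = real_of_int (- t x)"
      using s[OF that] s[OF tight_antipodal[OF that]] t[OF that] t[OF tight_antipodal[OF that]] by simp_all
    then show "s (- x) = - s x" "t (- x) = - t x" by (simp_all only: of_int_eq_iff)
  qed
  have X0: "0 \<notin> X" using tight_design(3) by auto
  have sd: "real d = r * r" by (simp add: r_def)
  have d3: "real d ^ 3 - real d = real d * ((real d)\<^sup>2 - 1)"
    by (simp add: power2_eq_square power3_eq_cube algebra_simps)
  have st: "of_int (\<Sum>x\<in>X. s x * t x) = (real d ^ 3 - real d) * (3 * (real d)\<^sup>2 - 2) * (a \<bullet> b)"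
  proof -
    have "of_int (\<Sum>x\<in>X. s x * t x) = (\<Sum>x\<in>X. real d * ((a \<bullet> x) * (b \<bullet> x)))"
      unfolding of_int_sum
    proof (intro sum.cong refl)
      fix x assume x: "x \<in> X"
      show "of_int (s x * t x) = real d * ((a \<bullet> x) * (b \<bullet> x))"
        unfolding of_int_mult of_int_power s[OF x] t[OF x] sd by algebra
    qed
    then show ?thesis
      unfolding sum_distrib_left[symmetric] tight_polarized_power_sums d3 by simp
  qed
  have s3t: "of_int (\<Sum>x\<in>X. s x ^ 3 * t x) = 3 * real d * (real d ^ 3 - real d) * (a \<bullet> a) * (a \<bullet> b)"
  proof -
    have "of_int (\<Sum>x\<in>X. s x ^ 3 * t x) = (\<Sum>x\<in>X. (real d)\<^sup>2 * ((a \<bullet> x) ^ 3 * (b \<bullet> x)))"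
      unfolding of_int_sum
    proof (intro sum.cong refl)
      fix x assume x: "x \<in> X"
      show "of_int (s x ^ 3 * t x) = (real d)\<^sup>2 * ((a \<bullet> x) ^ 3 * (b \<bullet> x))"
        unfolding of_int_mult of_int_power s[OF x] t[OF x] sd by algebra
    qed
    then show ?thesis
      unfolding sum_distrib_left[symmetric] tight_polarized_power_sums d3 by (simp add: power2_eq_square)
  qed
  have s5t: "of_int (\<Sum>x\<in>X. s x ^ 5 * t x) = 5 * (real d ^ 3 - real d) * (a \<bullet> a)\<^sup>2 * (a \<bullet> b)"
  proof -
    have "of_int (\<Sum>x\<in>X. s x ^ 5 * t x) = (\<Sum>x\<in>X. (real d)^3 * ((a \<bullet> x) ^ 5 * (b \<bullet> x)))"
      unfolding of_int_sum
    proof (intro sum.cong refl)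
      fix x assume x: "x \<in> X"
      show "of_int (s x ^ 5 * t x) = (real d)^3 * ((a \<bullet> x) ^ 5 * (b \<bullet> x))"
        unfolding of_int_mult of_int_power s[OF x] t[OF x] sd by algebra
    qed
    then show ?thesis
      unfolding sum_distrib_left[symmetric] tight_polarized_power_sums d3
      using d2 by (simp add: power2_eq_square power3_eq_cube)
  qed
  show "\<exists>k. (real d ^ 3 - real d) * (3 * (real d)\<^sup>2 - 2) * (a \<bullet> b) = of_int k"
    using st by metis
  let ?f = "\<lambda>x. s x * ((s x)\<^sup>2 - 1) * ((s x)\<^sup>2 - 4) * t x"
  have "(\<Sum>x\<in>X. ?f x) = (\<Sum>x\<in>X. s x ^ 5 * t x) - 5 * (\<Sum>x\<in>X. s x ^ 3 * t x) + 4 * (\<Sum>x\<in>X. s x * t x)"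
    unfolding sum_distrib_left sum_subtractf[symmetric] sum.distrib[symmetric]
    by (intro sum.cong refl) algebra
  then have "real_of_int (\<Sum>x\<in>X. ?f x) = of_int (\<Sum>x\<in>X. s x ^ 5 * t x) - 5 * of_int (\<Sum>x\<in>X. s x ^ 3 * t x) + 4 * of_int (\<Sum>x\<in>X. s x * t x)"
    by simp
  also have "\<dots> = (real d ^ 3 - real d) * (a \<bullet> b) * (5 * (a \<bullet> a)\<^sup>2 - 15 * real d * (a \<bullet> a) + 12 * (real d)\<^sup>2 - 8)"
    unfolding s5t s3t st by algebra
  finally have f: "real_of_int (\<Sum>x\<in>X. ?f x) = \<dots>" .
  have witness: "\<exists>k. w = numeral m * of_int k" if "real_of_int z = w" "z = numeral m * k" for w z m k
    using that by auto
  have even: "?f (- x) = ?f x" if "x \<in> X" for x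
    by (simp add: neg[OF that])
  have "2 * 120 dvd (\<Sum>x\<in>X. ?f x)"
    using tight_design(2) tight_antipodal X0 even 
    by (rule sum_even_function_dvd) (assumption | rule dvd_mult2[OF product_of_five_consecutive(1)])+
  then obtain k where k: "(\<Sum>x\<in>X. ?f x) = 2 * 120 * k" by (rule dvdE)
  show "\<exists>k. (real d ^ 3 - real d) * (a \<bullet> b) * (5 * (a \<bullet> a)\<^sup>2 - 15 * real d * (a \<bullet> a) + 12 * (real d)\<^sup>2 - 8) = 240 * of_int k"
    by (rule witness[OF f]) (simp add: k)
  assume "a = b"
  then have ts: "t x = s x" for x by (simp add: s_def t_def)
  have "2 * 360 dvd (\<Sum>x\<in>X. ?f x)"
    using tight_design(2) tight_antipodal X0 even unfolding ts
    by (rule sum_even_function_dvd) (assumption | rule product_of_five_consecutive(2))+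
  then obtain k where k: "(\<Sum>x\<in>X. ?f x) = 2 * 360 * k" by (rule dvdE)
  show "\<exists>k. (real d ^ 3 - real d) * (a \<bullet> a) * (5 * (a \<bullet> a)\<^sup>2 - 15 * real d * (a \<bullet> a) + 12 * (real d)\<^sup>2 - 8) = 720 * of_int k"
    by (rule witness[OF f[folded \<open>a = b\<close>]]) (simp add: k)
qed

end

theorem theorem3p3:
  fixes d :: nat
  assumes "d \<ge> 2"
    and "\<And>p :: nat. prime p \<Longrightarrow> p \<ge> 5 \<Longrightarrow> multiplicity p (d ^ 3 - d) \<le> 2"
    and "multiplicity 3 (d ^ 3 - d) \<le> 4"
    and "multiplicity 2 d \<in> {2, 3, 4}"
    and "CARD('n::finite) = 3 * d ^ 2 - 4"
  shows "\<not> (\<exists>X :: (real ^ 'n) set. tight_spherical_7_design X)"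
proof
  assume "\<exists>X :: (real ^ 'n) set. tight_spherical_7_design X"
  then obtain X :: "(real ^ 'n) set" where X: "tight_spherical_7_design X" ..
  note D = X assms(1,5)
  note A = assms(1-4)
  let ?L = "design_dual X d"
  have four: "4 dvd d" using A by (rule four_dvd)
  have gt: "1 < real d" "1 < (real d)\<^sup>2" using tight_d_gt_1[OF D] by auto
  have norm: "a \<bullet> a \<in> \<int>" if a: "a \<in> ?L" for a
  proof -
    let ?E = "(real d ^ 3 - real d) * (3 * (real d)\<^sup>2 - 2)"
    obtain k where k: "?E * (a \<bullet> a) = of_int k"
      using design_dual_sums(1)[OF D a a] by blast
    have "real d < real d ^ 3" using power_strict_increasing[of 1 3 "real d"] gt by simp
    then have "?E > 0" using gt(2) by (intro mult_pos_pos) linarith+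
    then have "?E \<noteq> 0" by (metis order_less_irrefl)
    then have "a \<bullet> a = of_int k / ?E" by (metis k nonzero_mult_div_cancel_left)
    also have "\<dots> \<in> \<rat>" by (intro Rats_divide Rats_mult Rats_diff Rats_power) auto
    finally have "a \<bullet> a \<in> \<rat>" .
    then show ?thesis
      using design_dual_sums(3)[OF D a a refl] norm_integral[OF A] by blast
  qed
  have double: "2 * (a \<bullet> b) \<in> \<int>" if "a \<in> ?L" "b \<in> ?L" for a b
  proof -
    have "2 * (a \<bullet> b) = (a + b) \<bullet> (a + b) - a \<bullet> a - b \<bullet> b" by (simp add: inner_add inner_commute)
    then show ?thesis using norm[OF design_dual_add[OF that]] norm[OF that(1)] norm[OF that(2)] by simp
  qed
  have inner_odd: "a \<bullet> b \<in> \<int>" if "a \<in> ?L" "b \<in> ?L" "a \<bullet> a = of_int m" "odd m" for a b m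
    using inner_integral[OF A that(3,4) double[OF that(1,2)]] design_dual_sums(2)[OF D that(1,2)] by blast
  have inner: "a \<bullet> b \<in> \<int>" if a: "a \<in> ?L" and b: "b \<in> ?L" for a b
  proof -
    obtain k l m where k: "a \<bullet> a = of_int k" and l: "b \<bullet> b = of_int l" and m: "2 * (a \<bullet> b) = of_int m"
      using norm[OF a] norm[OF b] double[OF a b] by (auto elim!: Ints_cases)
    consider "odd k" | "odd l" | "even m" | "even k" "even l" "odd m" by blast
    then show ?thesis
    proof cases
      case 1
      then show ?thesis using inner_odd a b k by blast
    next
      case 2
      then show ?thesis using inner_odd[OF b a l] by (simp add: inner_commute)
    next
      case 3
      then obtain j where "m = 2 * j" by blast
      then have "a \<bullet> b = of_int j" using m by simp
      then show ?thesis by simp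
    next
      case 4
      \<comment> \<open>With both norms even the cofactor in the congruence is even and
        \<open>inner_odd\<close> does not apply to \<open>a\<close> or \<open>b\<close>. Oddness of
        \<open>m\<close> gives \<open>a + b\<close> an odd norm, and subtracting
        \<open>b \<bullet> b\<close> recovers the inner product.\<close>
      have "(a + b) \<bullet> (a + b) = of_int (k + l + m)"
        using k l m by (simp add: inner_add inner_commute)
      then have "(a + b) \<bullet> b \<in> \<int>"
        using 4 design_dual_add[OF a b] b by (intro inner_odd[of _ _ "k + l + m"]) auto
      then have "(a + b) \<bullet> b - b \<bullet> b \<in> \<int>" using l by simp
      then show ?thesis by (simp add: inner_add_left)
    qed
  qed
  have scaled: "sqrt d *\<^sub>R x \<in> ?L" if "x \<in> X" for x
    using tight_scaled_inner_integral[OF D that] by (simp add: design_dual_def flip: mult.assoc)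
  have "8 dvd CARD('n)"
  proof (rule lattice_dim[of ?L])
    fix a assume a: "\<And>b. b \<in> ?L \<Longrightarrow> b \<bullet> b / 2 \<in> \<int> \<Longrightarrow> a \<bullet> b \<in> \<int>"
    show "a \<in> ?L"
      unfolding design_dual_def mem_Collect_eq
    proof
      fix x assume x: "x \<in> X"
      \<comment> \<open>The scaled design vectors have norm \<open>d\<close>, which is even, so the
        duality hypothesis can be tested on them.\<close>
      obtain j where j: "d = 2 * j" using four by (metis dvd_def dvd_trans even_numeral)
      have "(sqrt d *\<^sub>R x) \<bullet> (sqrt d *\<^sub>R x) / 2 = real j"
        using tight_unit[OF D x] by (simp add: j flip: mult.assoc)
      then show "sqrt d * (a \<bullet> x) \<in> \<int>" using a[OF scaled[OF x]] by simp
    qed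
  next
    show "span ?L = UNIV"
    proof (rule ccontr)
      assume "span ?L \<noteq> UNIV"
      then obtain a where a: "a \<noteq> 0" "\<And>y. y \<in> span ?L \<Longrightarrow> a \<bullet> y = 0"
        using span_not_UNIV_orthogonal[of ?L] by blast
      \<comment> \<open>A vector orthogonal to \<open>L\<close> is orthogonal to the scaled design
        inside it, contradicting the nonzero second moment.\<close>
      have "a \<bullet> x = 0" if "x \<in> X" for x
        using a(2)[OF span_base[OF scaled[OF that]]] gt by simp
      then have "((real d)\<^sup>2 - 1) * (3 * (real d)\<^sup>2 - 2) * (a \<bullet> a) = 0"
        using tight_power_sums(1)[OF D, of a] by simp
      then show False using gt a(1) by simp
    qed
  qed (rule inner)
  \<comment> \<open>Adding 4 undoes the truncated subtraction in the dimension: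
    \<open>n + 4 = 3 * d ^ 2\<close>, a multiple of 48.\<close>
  moreover have "8 dvd CARD('n) + 4"
  proof -
    obtain j where "d = 4 * j" using four by blast
    moreover have "4 \<le> 3 * d ^ 2" using power_mono[of 2 d 2] assms(1) by simp
    ultimately have "CARD('n) + 4 = 8 * (6 * j ^ 2)"
      using assms(5) by (simp add: power_mult_distrib)
    then show ?thesis by simp
  qed
  ultimately have "8 dvd (4 :: nat)" using dvd_add_right_iff by blast
  then show False by simp
qed

end
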